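(* Let $H$ be a Hilbert space, let $P_1,P_2$ be (orthogonal) projections on $H$ with $P_1+P_2=1$ and $\dim(P_2H)<\infty$, and let $\Phi(x)=(P_1x,x)-(P_2x,x)$ for $x\in H$. Let $\pi$ be a bounded representation of a group $G$ on $H$ which preserves $\Phi$, that is, $\Phi(\pi(g)x)=\Phi(x)$ for all $x\in H$, $g\in G$. Then $\pi$ is similar to a unitary representation. Moreover, $$c(\pi)\le 2\|\pi\|^2+1.$$
   Context: A representation $\pi$ of a group $G$ on a Hilbert space $H$ is a homomorphism from $G$ into the group of invertible bounded linear operators on $H$. It is bounded if $\|\pi\|:=\sup_{g\in G}\|\pi(g)\|<\infty$. It is similar to a unitary representation if there are an invertible bounded operator $V$ and a unitary representation $U$ of $G$ such that $\pi(g)=V^{-1}U(g)V$ for all $g\in G$. The constant of similarity $c(\pi)$ is the infimum of the values $\|V\|\,\|V^{-1}\|$ over all such $V$. The number $\dim(P_2H)$ is called the number of negative squares of the form $\Phi$. *)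

theory Defs
  imports "HOL-Analysis.Analysis" "HOL-Algebra.Group"
begin

(* Complex inner product spaces, with the inner product linear in the first argument.  Positivity,
   definiteness and the norm are inherited from real_inner through inner_eq_Re_cinner. *)
class complex_inner = real_inner +
  fixes scaleC :: "complex \<Rightarrow> 'a \<Rightarrow> 'a"  (infixr "*\<^sub>C" 75)
    and cinner :: "'a \<Rightarrow> 'a \<Rightarrow> complex"
  assumes scaleC_add_right: "a *\<^sub>C (x + y) = a *\<^sub>C x + a *\<^sub>C y"
    and scaleC_add_left: "(a + b) *\<^sub>C x = a *\<^sub>C x + b *\<^sub>C x"
    and scaleC_scaleC: "a *\<^sub>C b *\<^sub>C x = (a * b) *\<^sub>C x"
    and scaleC_of_real: "complex_of_real r *\<^sub>C x = r *\<^sub>R x"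
    and cinner_commute: "cinner x y = cnj (cinner y x)"
    and cinner_add_left: "cinner (x + y) z = cinner x z + cinner y z"
    and cinner_scaleC_left: "cinner (a *\<^sub>C x) y = a * cinner x y"
    and inner_eq_Re_cinner: "inner x y = Re (cinner x y)"

class complex_hilbert = complex_inner + complete_space

instantiation complex :: complex_hilbert
begin

definition scaleC_complex :: "complex \<Rightarrow> complex \<Rightarrow> complex"
  where "scaleC_complex a x = a * x"

definition cinner_complex :: "complex \<Rightarrow> complex \<Rightarrow> complex"
  where "cinner_complex x y = x * cnj y"

instance
  by standard
    (auto simp: scaleC_complex_def cinner_complex_def algebra_simps inner_complex_def scaleR_conv_of_real)

end

global_interpretation complex_vector:
  vector_space "scaleC :: complex \<Rightarrow> 'a \<Rightarrow> 'a::complex_inner"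
proof
  show "1 *\<^sub>C x = x" for x :: 'a
    using scaleC_of_real[of 1 x] by simp
qed (simp_all add: scaleC_add_right scaleC_add_left scaleC_scaleC)

(* The type of bounded operators only provides real linearity; its norm does not depend on the
   scalar field. *)
definition complex_linear :: "('h::complex_inner \<Rightarrow>\<^sub>L 'h) \<Rightarrow> bool"
  where "complex_linear T \<longleftrightarrow> (\<forall>a x. blinfun_apply T (a *\<^sub>C x) = a *\<^sub>C blinfun_apply T x)"

definition invertible_operators :: "('h::complex_inner \<Rightarrow>\<^sub>L 'h) monoid"
  where "invertible_operators =
    \<lparr>carrier = {T. complex_linear T \<and>
        (\<exists>S. complex_linear S \<and> S o\<^sub>L T = id_blinfun \<and> T o\<^sub>L S = id_blinfun)},
     mult = (o\<^sub>L),
     one = id_blinfun\<rparr>"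

lemma group_invertible_operators: "group (invertible_operators :: ('h::complex_inner \<Rightarrow>\<^sub>L 'h) monoid)"
proof (rule groupI)
  fix S T :: "'h \<Rightarrow>\<^sub>L 'h"
  assume "S \<in> carrier invertible_operators" "T \<in> carrier invertible_operators"
  then obtain S' T' where *: "complex_linear S" "complex_linear S'" "complex_linear T" "complex_linear T'"
    and inv: "S' o\<^sub>L S = id_blinfun" "S o\<^sub>L S' = id_blinfun" "T' o\<^sub>L T = id_blinfun" "T o\<^sub>L T' = id_blinfun"
    by (auto simp: invertible_operators_def)
  have pt: "S' (S x) = x" "S (S' x) = x" "T' (T x) = x" "T (T' x) = x" for x
    using inv by (metis blinfun_apply_blinfun_compose id_blinfun.rep_eq id_apply)+
  have "(T' o\<^sub>L S') o\<^sub>L (S o\<^sub>L T) = id_blinfun" "(S o\<^sub>L T) o\<^sub>L (T' o\<^sub>L S') = id_blinfun"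
    by (auto intro!: blinfun_eqI simp: pt)
  moreover have "complex_linear (S o\<^sub>L T)" "complex_linear (T' o\<^sub>L S')"
    using * by (simp_all add: complex_linear_def)
  ultimately show "S \<otimes>\<^bsub>invertible_operators\<^esub> T \<in> carrier invertible_operators"
    unfolding invertible_operators_def by auto
next
  fix T :: "'h \<Rightarrow>\<^sub>L 'h"
  assume "T \<in> carrier invertible_operators"
  then show "\<exists>S\<in>carrier invertible_operators. S \<otimes>\<^bsub>invertible_operators\<^esub> T = \<one>\<^bsub>invertible_operators\<^esub>"
    by (auto simp: invertible_operators_def)
qed (auto simp: invertible_operators_def complex_linear_def intro!: exI[of _ id_blinfun] blinfun_eqI)

definition representation :: "('g, 'm) monoid_scheme \<Rightarrow> ('g \<Rightarrow> 'h::complex_inner \<Rightarrow>\<^sub>L 'h) \<Rightarrow> bool"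
  where "representation G \<pi> \<longleftrightarrow> \<pi> \<in> hom G invertible_operators"

definition bounded_representation :: "('g, 'm) monoid_scheme \<Rightarrow> ('g \<Rightarrow> 'h::complex_inner \<Rightarrow>\<^sub>L 'h) \<Rightarrow> bool"
  where "bounded_representation G \<pi> \<longleftrightarrow>
    representation G \<pi> \<and> bdd_above ((\<lambda>g. norm (\<pi> g)) ` carrier G)"

definition rep_norm :: "('g, 'm) monoid_scheme \<Rightarrow> ('g \<Rightarrow> 'h::complex_inner \<Rightarrow>\<^sub>L 'h) \<Rightarrow> real"
  where "rep_norm G \<pi> = (SUP g\<in>carrier G. norm (\<pi> g))"

(* Surjectivity of the operators is part of representation. *)
definition unitary_representation :: "('g, 'm) monoid_scheme \<Rightarrow> ('g \<Rightarrow> 'h::complex_inner \<Rightarrow>\<^sub>L 'h) \<Rightarrow> bool"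
  where "unitary_representation G U \<longleftrightarrow> representation G U \<and>
    (\<forall>g\<in>carrier G. \<forall>x y. cinner (U g x) (U g y) = cinner x y)"

definition unitarizes ::
  "('g, 'm) monoid_scheme \<Rightarrow> ('g \<Rightarrow> 'h::complex_inner \<Rightarrow>\<^sub>L 'h) \<Rightarrow> ('h \<Rightarrow>\<^sub>L 'h) \<Rightarrow> bool"
  where "unitarizes G \<pi> V \<longleftrightarrow> V \<in> carrier invertible_operators \<and>
    (\<exists>U. unitary_representation G U \<and>
      (\<forall>g\<in>carrier G. \<pi> g = inv\<^bsub>invertible_operators\<^esub> V o\<^sub>L U g o\<^sub>L V))"

definition similar_to_unitary :: "('g, 'm) monoid_scheme \<Rightarrow> ('g \<Rightarrow> 'h::complex_inner \<Rightarrow>\<^sub>L 'h) \<Rightarrow> bool"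
  where "similar_to_unitary G \<pi> \<longleftrightarrow> (\<exists>V. unitarizes G \<pi> V)"

(* Meaningful only if similar_to_unitary holds: otherwise this is the infimum of the empty set of
   reals. *)
definition similarity_constant :: "('g, 'm) monoid_scheme \<Rightarrow> ('g \<Rightarrow> 'h::complex_inner \<Rightarrow>\<^sub>L 'h) \<Rightarrow> real"
  where "similarity_constant G \<pi> =
    Inf {norm V * norm (inv\<^bsub>invertible_operators\<^esub> V) | V. unitarizes G \<pi> V}"

definition orthogonal_projection :: "('h::complex_inner \<Rightarrow>\<^sub>L 'h) \<Rightarrow> bool"
  where "orthogonal_projection P \<longleftrightarrow> complex_linear P \<and> P o\<^sub>L P = P \<and>
    (\<forall>x y. cinner (P x) y = cinner x (P y))"

(* Stated with a finite spanning set because the library dimension of an infinite-dimensional space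
   is 0. *)
definition finite_dimensional :: "'h::complex_inner set \<Rightarrow> bool"
  where "finite_dimensional W \<longleftrightarrow> (\<exists>B. finite B \<and> W = complex_vector.span B)"

(* Complex-valued as written, although its values are real. *)
definition indefinite_form :: "('h::complex_inner \<Rightarrow>\<^sub>L 'h) \<Rightarrow> ('h \<Rightarrow>\<^sub>L 'h) \<Rightarrow> 'h \<Rightarrow> complex"
  where "indefinite_form P1 P2 x = cinner (P1 x) x - cinner (P2 x) x"

end

(* Write J = P1 - P2.  For a Phi-selfadjoint operator Q put b(x) = -Phi(Qx, x), and consider the
   convex set of all Q with b >= 0, Phi + b >= 0, b(pi(g)x) <= M^2 |x|^2 for all g, and trace of
   b o pi(g) bounded uniformly in g.  The group acts on this set by conjugation, P2 belongs to it, and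
   F(Q) = sup_g tr(b o pi(g)) is an invariant convex functional.  If v = Q(1 - Q)z, then subtracting a
   small multiple of |Phi(., v)|^2 from b stays in the set and lowers F by a definite multiple of
   |v|^2, so near-minimisers are almost idempotent.  Applied to (Q + Q')/2 this makes (Q - Q')^2
   small, and then, since Phi is definite on the range and on the kernel of Q, also Q - Q'.  Hence
   minimising sequences converge, and the limit P is an idempotent commuting with the group.  The form
   Phi(x) + 2b(x), with operator A = J(1 - 2P), is invariant, at most (2M^2 + 1)|x|^2, and at least
   |x|^2/(2M^2 + 1) because it dominates |Phi|; take V = sqrt A.

   The argument only needs real scalars: applied to the group of all a pi(g) with |a| = 1, uniqueness of
   the limit also gives complex linearity of P. *)

theory Submission
  imports Defs
begin

section \<open>Finite orthonormal systems: Gram-Schmidt, Parseval and Bessel\<close>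

definition orthonormal :: "'a::real_inner set \<Rightarrow> bool"
  where "orthonormal S \<longleftrightarrow> pairwise orthogonal S \<and> (\<forall>u\<in>S. norm u = 1)"

lemma orthonormal_inner:
  assumes "orthonormal S" "u \<in> S" "v \<in> S"
  shows "u \<bullet> v = (if u = v then 1 else 0)"
  using assms by (auto simp: orthonormal_def pairwise_def orthogonal_def dot_square_norm)

lemma orthonormal_sum_inner:
  assumes "finite S" "orthonormal S" "v \<in> S"
  shows "(\<Sum>u\<in>S. c u *\<^sub>R u) \<bullet> v = c v"
proof -
  have "(\<Sum>u\<in>S. c u *\<^sub>R u) \<bullet> v = (\<Sum>u\<in>S. if u = v then c u else 0)"
    unfolding inner_sum_left by (rule sum.cong) (auto simp: orthonormal_inner[OF assms(2) _ assms(3)])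
  then show ?thesis using assms by simp
qed

text \<open>One Gram-Schmidt step: the residue of \<open>w\<close> after projection onto
  \<open>span S\<close> is normalised and adjoined, unless it vanishes.\<close>

lemma orthonormal_extend:
  fixes w :: "'a::real_inner"
  assumes "finite S" "orthonormal S"
  obtains S' where "S \<subseteq> S'" "finite S'" "orthonormal S'" "w \<in> span S'"
proof -
  define p where "p = (\<Sum>u\<in>S. (w \<bullet> u) *\<^sub>R u)"
  define r where "r = w - p"
  have p: "p \<in> span S" unfolding p_def by (intro span_sum span_scale span_base)
  have rS: "r \<bullet> v = 0" if "v \<in> S" for v
    using orthonormal_sum_inner[OF assms that, of "\<lambda>u. w \<bullet> u"]
    by (simp add: r_def p_def inner_diff_left)
  show thesis
  proof (cases "r = 0")
    case True
    with p assms show thesis by (intro that[of S]) (auto simp: r_def)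
  next
    case False
    have "orthonormal (insert (r /\<^sub>R norm r) S)"
      using assms(2) False rS
      by (auto simp: orthonormal_def pairwise_insert orthogonal_def inner_commute)
    moreover have "w \<in> span (insert (r /\<^sub>R norm r) S)"
    proof -
      have "w = norm r *\<^sub>R (r /\<^sub>R norm r) + p" using False by (simp add: r_def)
      moreover have "norm r *\<^sub>R (r /\<^sub>R norm r) + p \<in> span (insert (r /\<^sub>R norm r) S)"
        by (intro span_add span_scale span_base insertI1 subsetD[OF span_mono p]) auto
      ultimately show ?thesis by simp
    qed
    ultimately show thesis using assms(1) by (intro that[of "insert (r /\<^sub>R norm r) S"]) auto
  qed
qed

lemma finite_orthonormal_spanning:
  fixes C :: "'a::real_inner set"
  assumes "finite C"
  obtains E where "finite E" "orthonormal E" "C \<subseteq> span E"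
proof -
  have "\<exists>E. finite E \<and> orthonormal E \<and> C \<subseteq> span E"
    using assms
  proof (induction C)
    case empty
    show ?case by (rule exI[of _ "{}"]) (auto simp: orthonormal_def)
  next
    case (insert c C)
    then obtain E where E: "finite E" "orthonormal E" "C \<subseteq> span E" by blast
    obtain E' where "E \<subseteq> E'" "finite E'" "orthonormal E'" "c \<in> span E'"
      using orthonormal_extend[OF E(1,2)] by metis
    with E(3) span_mono[of E E'] show ?case by (intro exI[of _ E']) auto
  qed
  then show thesis using that by blast
qed

lemma orthonormal_parseval:
  assumes "finite S" "orthonormal S" "x \<in> span S"
  shows "(\<Sum>u\<in>S. (u \<bullet> x)\<^sup>2) = (norm x)\<^sup>2"
proof -
  obtain c where c: "x = (\<Sum>u\<in>S. c u *\<^sub>R u)"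
    using assms by (auto simp: span_finite)
  have xu: "u \<bullet> x = c u" if "u \<in> S" for u
    using orthonormal_sum_inner[OF assms(1,2) that, of c] by (simp add: c inner_commute)
  have "(norm x)\<^sup>2 = x \<bullet> (\<Sum>u\<in>S. c u *\<^sub>R u)" using c by (simp add: dot_square_norm)
  also have "\<dots> = (\<Sum>u\<in>S. (u \<bullet> x)\<^sup>2)"
    unfolding inner_sum_right
    by (rule sum.cong) (auto simp: xu power2_eq_square inner_commute[of x])
  finally show ?thesis by simp
qed

text \<open>Bessel's inequality for a functional, without a Riesz representative: at the vector
  \<open>w\<close> with coefficients \<open>f u\<close> one has
  \<open>f w = (norm w)\<^sup>2\<close>, which is compared with \<open>L * norm w\<close>.\<close>

lemma orthonormal_bessel:
  assumes "finite S" "orthonormal S" "linear f" "\<And>x. \<bar>f x\<bar> \<le> L * norm x"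
  shows "(\<Sum>u\<in>S. (f u)\<^sup>2) \<le> (L::real)\<^sup>2"
proof -
  define w where "w = (\<Sum>u\<in>S. f u *\<^sub>R u)"
  have fw: "f w = (\<Sum>u\<in>S. (f u)\<^sup>2)"
    by (simp add: w_def linear_sum[OF assms(3)] linear_scale[OF assms(3)] power2_eq_square)
  have "w \<in> span S" unfolding w_def by (intro span_sum span_scale span_base)
  from orthonormal_parseval[OF assms(1,2) this]
  have nw: "(norm w)\<^sup>2 = (\<Sum>u\<in>S. (f u)\<^sup>2)"
    using orthonormal_sum_inner[OF assms(1,2), of _ f] by (simp add: w_def inner_commute)
  have "norm w * norm w \<le> L * norm w"
    using assms(4)[of w] fw nw by (simp add: power2_eq_square)
  show ?thesis
  proof (cases "norm w = 0")
    case True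
    then show ?thesis using nw by simp
  next
    case False
    then have "norm w \<le> L"
      using mult_right_le_imp_le[OF \<open>norm w * norm w \<le> L * norm w\<close>] by simp
    then have "(norm w)\<^sup>2 \<le> L\<^sup>2" by (intro power_mono) auto
    then show ?thesis using nw by simp
  qed
qed

section \<open>Auxiliary inequalities: triangle and semidefinite Cauchy-Schwarz\<close>

lemma norm_diff_diff_le:
  fixes x y z :: "'a::real_normed_vector"
  shows "norm (x - y - z) \<le> norm x + norm y + norm z"
  using norm_triangle_ineq4[of "x - y" z] norm_triangle_ineq4[of x y] by linarith

lemma Cauchy_Schwarz_semidefinite:
  fixes f :: "'a::real_vector \<Rightarrow> 'a \<Rightarrow> real"
  assumes sym: "\<And>x y. f x y = f y x" and lin: "\<And>x. linear (f x)" and pos: "\<And>x. 0 \<le> f x x"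
  shows "(f x y)\<^sup>2 \<le> f x x * f y y"
proof -
  have add: "f (a + b) c = f a c + f b c" and scale: "f (r *\<^sub>R a) c = r * f a c" for a b c r
    using sym[of _ c] linear_add[OF lin, of c] linear_scale[OF lin, of c] by simp_all
  have expand: "f (s *\<^sub>R x + t *\<^sub>R y) (s *\<^sub>R x + t *\<^sub>R y) = s\<^sup>2 * f x x + 2 * s * t * f x y + t\<^sup>2 * f y y" for s t
    using sym[of x y]
    by (simp add: linear_add[OF lin] linear_scale[OF lin] add scale power2_eq_square algebra_simps)
  show ?thesis
  proof (cases "f y y = 0")
    case True
    have "f x y = 0"
    proof (rule ccontr)
      assume "f x y \<noteq> 0"
      \<comment> \<open>Since \<open>f y y = 0\<close>, the quadratic polynomial is affine in
        \<open>t\<close>; this choice gives it the value -1.\<close>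
      define t where "t = - (f x x + 1) / (2 * f x y)"
      have "2 * t * f x y = - (f x x + 1)" using \<open>f x y \<noteq> 0\<close> by (simp add: t_def)
      then show False
        using pos[of "1 *\<^sub>R x + t *\<^sub>R y"] unfolding expand True by simp
    qed
    then show ?thesis using True by simp
  next
    case False
    then have fy: "f y y > 0" using pos[of y] by simp
    \<comment> \<open>The usual minimising combination of \<open>x\<close> and \<open>y\<close>,
      cleared of its denominator.\<close>
    have "0 \<le> f y y * (f x x * f y y - (f x y)\<^sup>2)"
      using pos[of "f y y *\<^sub>R x + (- f x y) *\<^sub>R y"] unfolding expand
      by (simp add: power2_eq_square algebra_simps)
    then show ?thesis using fy by (simp add: zero_le_mult_iff)
  qed
qed

section \<open>Groups of Phi-isometries and admissible operators\<close>

text \<open>With J = P1 - P2 one has x - J x = 2 P2 x, so \<open>finite_negative\<close> expresses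
  finitely many negative squares. The group is a set of operators, not the image of a
  representation, so that unimodular multiples can be included.\<close>

locale bounded_isometry_group =
  fixes J :: "'h::{real_inner,banach} \<Rightarrow>\<^sub>L 'h"
    and \<G> :: "('h \<Rightarrow>\<^sub>L 'h) set"
    and M :: real
  assumes J_sym: "J x \<bullet> y = x \<bullet> J y"
    and J_J [simp]: "J (J x) = x"
    and id_in: "id_blinfun \<in> \<G>"
    and comp_in: "S \<in> \<G> \<Longrightarrow> T \<in> \<G> \<Longrightarrow> S o\<^sub>L T \<in> \<G>"
    and inv_in: "T \<in> \<G> \<Longrightarrow> \<exists>T'\<in>\<G>. (\<forall>x. T' (T x) = x) \<and> (\<forall>x. T (T' x) = x)"
    and isometric: "T \<in> \<G> \<Longrightarrow> J (T x) \<bullet> T x = J x \<bullet> x"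
    and norm_le: "T \<in> \<G> \<Longrightarrow> norm T \<le> M"
    and M_ge_1: "1 \<le> M"
    and finite_negative: "\<exists>C. finite C \<and> (\<forall>x. x - J x \<in> span C)"
begin

lemma norm_J [simp]: "norm (J x) = norm x"
  by (simp add: norm_eq_sqrt_inner J_sym)

lemma form_bound: "\<bar>J x \<bullet> y\<bar> \<le> norm x * norm y"
  using Cauchy_Schwarz_ineq2[of "J x" y] by simp

lemma form_commute: "J x \<bullet> y = J y \<bullet> x"
  by (metis J_sym inner_commute)

lemma isometric2:
  assumes "T \<in> \<G>"
  shows "J (T x) \<bullet> T y = J x \<bullet> y"
  using isometric[OF assms, of "x + y"] isometric[OF assms, of x] isometric[OF assms, of y]
    form_commute[of "T x" "T y"] form_commute[of x y]
  by (simp add: blinfun.add_right inner_add_left inner_add_right)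

lemma norm_apply_le:
  assumes "T \<in> \<G>"
  shows "norm (T x) \<le> M * norm x"
  using norm_blinfun[of T x] norm_le[OF assms] by (meson mult_right_mono norm_ge_zero order_trans)

text \<open>The polarisation of b. The sign is chosen so that Q = P2 yields the positive form (P2 x,
  y).\<close>

definition neg_form :: "('h \<Rightarrow>\<^sub>L 'h) \<Rightarrow> 'h \<Rightarrow> 'h \<Rightarrow> real"
  where "neg_form Q x y = - (J (Q x) \<bullet> y)"

text \<open>For an idempotent \<open>Q\<close> the two positivity conditions say that Phi is
  nonpositive on its range and nonnegative on its kernel. The upper bound is imposed along whole
  orbits to make the set stable under conjugation by the group.\<close>

definition admissible :: "('h \<Rightarrow>\<^sub>L 'h) \<Rightarrow> bool"
  where "admissible Q \<longleftrightarrow>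
    (\<forall>x y. J (Q x) \<bullet> y = J x \<bullet> Q y) \<and>
    (\<forall>x. 0 \<le> neg_form Q x x) \<and>
    (\<forall>x. 0 \<le> J x \<bullet> x + neg_form Q x x) \<and>
    (\<forall>T\<in>\<G>. \<forall>x. neg_form Q (T x) (T x) \<le> M\<^sup>2 * (norm x)\<^sup>2)"

text \<open>Expresses F(Q) \<le> K without forming the supremum F(Q), which may be infinite; the
  trace of a positive form is the supremum of its finite orthonormal sums.\<close>

definition trace_le :: "('h \<Rightarrow>\<^sub>L 'h) \<Rightarrow> real \<Rightarrow> bool"
  where "trace_le Q K \<longleftrightarrow>
    (\<forall>T\<in>\<G>. \<forall>S. finite S \<longrightarrow> orthonormal S \<longrightarrow> (\<Sum>u\<in>S. neg_form Q (T u) (T u)) \<le> K)"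

lemma admissibleD:
  assumes "admissible Q"
  shows "J (Q x) \<bullet> y = J x \<bullet> Q y" "0 \<le> neg_form Q x x" "0 \<le> J x \<bullet> x + neg_form Q x x"
    "T \<in> \<G> \<Longrightarrow> neg_form Q (T x) (T x) \<le> M\<^sup>2 * (norm x)\<^sup>2"
    "neg_form Q x x \<le> M\<^sup>2 * (norm x)\<^sup>2"
proof -
  show "neg_form Q x x \<le> M\<^sup>2 * (norm x)\<^sup>2"
    using assms id_in unfolding admissible_def by fastforce
qed (use assms in \<open>auto simp: admissible_def\<close>)

lemma neg_form_commute:
  assumes "admissible Q"
  shows "neg_form Q x y = neg_form Q y x"
  using admissibleD(1)[OF assms, of x y] form_commute[of x "Q y"] by (simp add: neg_form_def)

lemma linear_neg_form: "linear (neg_form Q x)"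
  by (rule linearI) (simp_all add: neg_form_def inner_add_right)

lemma neg_form_CS:
  assumes "admissible Q"
  shows "(neg_form Q x y)\<^sup>2 \<le> neg_form Q x x * neg_form Q y y"
  by (intro Cauchy_Schwarz_semidefinite neg_form_commute linear_neg_form admissibleD assms)

lemma pos_form_CS:
  assumes "admissible Q"
  shows "(J x \<bullet> y + neg_form Q x y)\<^sup>2
    \<le> (J x \<bullet> x + neg_form Q x x) * (J y \<bullet> y + neg_form Q y y)"
proof (rule Cauchy_Schwarz_semidefinite)
  show "J x \<bullet> y + neg_form Q x y = J y \<bullet> x + neg_form Q y x" for x y
    using form_commute[of x y] neg_form_commute[OF assms, of x y] by simp
  show "linear (\<lambda>y. J x \<bullet> y + neg_form Q x y)" for x
    by (rule linearI) (simp_all add: neg_form_def inner_add_right algebra_simps)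
qed (rule admissibleD(3)[OF assms])

text \<open>Cauchy-Schwarz for b at the pair \<open>x\<close>, \<open>J (Q x)\<close>, where the
  form takes the value \<open>- (norm (Q x))\<^sup>2\<close>.\<close>

lemma admissible_norm_le:
  assumes "admissible Q"
  shows "norm (Q x) \<le> M\<^sup>2 * norm x"
proof -
  have "neg_form Q x (J (Q x)) = - (norm (Q x))\<^sup>2"
    by (simp add: neg_form_def dot_square_norm)
  moreover have "(neg_form Q x (J (Q x)))\<^sup>2 \<le> (M\<^sup>2 * (norm x)\<^sup>2) * (M\<^sup>2 * (norm (J (Q x)))\<^sup>2)"
    by (rule order_trans[OF neg_form_CS[OF assms]])
       (intro mult_mono admissibleD(5)[OF assms] admissibleD(2)[OF assms]; simp)
  ultimately have "((norm (Q x))\<^sup>2)\<^sup>2 \<le> (M\<^sup>2 * norm x * norm (Q x))\<^sup>2"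
    by (simp add: power2_eq_square algebra_simps)
  then have "(norm (Q x))\<^sup>2 \<le> M\<^sup>2 * norm x * norm (Q x)"
    by (rule power2_le_imp_le) simp
  then show ?thesis
    by (cases "Q x = 0") (auto simp: power2_eq_square)
qed

lemma majorant_lower_bound:
  assumes "admissible Q"
  shows "(norm x)\<^sup>2 \<le> (2 * M\<^sup>2 + 1) * (J x \<bullet> x + 2 * neg_form Q x x)"
proof -
  define \<kappa> where "\<kappa> = 2 * M\<^sup>2 + 1"
  have \<kappa>: "\<kappa> > 0" unfolding \<kappa>_def by (intro add_nonneg_pos) auto
  let ?A = "\<lambda>x y. J x \<bullet> y + 2 * neg_form Q x y"
  have up: "?A y y \<le> \<kappa> * (norm y)\<^sup>2" for y
    using form_bound[of y y] admissibleD(5)[OF assms, of y]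
    by (simp add: \<kappa>_def power2_eq_square algebra_simps)
  \<comment> \<open>The differences A - Phi = 2b and A + Phi = 2(Phi + b) are both
    nonnegative.\<close>
  have le: "J y \<bullet> y \<le> ?A y y" "- (J y \<bullet> y) \<le> ?A y y" for y
    using admissibleD(2,3)[OF assms, of y] by linarith+
  \<comment> \<open>Polarise \<open>\<Phi>(x, J x) = (norm x)\<^sup>2\<close> using \<open>\<bar>\<Phi>\<bar> \<le> A\<close>.\<close>
  define y where "y = J x /\<^sub>R \<kappa>"
  have "4 * (J x \<bullet> y) = J (x + y) \<bullet> (x + y) - J (x - y) \<bullet> (x - y)"
    using form_commute[of x y] by (simp add: blinfun.bilinear_simps inner_simps)
  also have "\<dots> \<le> ?A (x + y) (x + y) + ?A (x - y) (x - y)"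
    using le(1)[of "x + y"] le(2)[of "x - y"] by simp
  also have "\<dots> = 2 * ?A x x + 2 * ?A y y"
    by (simp add: neg_form_def blinfun.bilinear_simps inner_simps)
  also have "\<dots> \<le> 2 * ?A x x + 2 * (\<kappa> * (norm y)\<^sup>2)"
    using up[of y] by simp
  finally have "4 * ((norm x)\<^sup>2 / \<kappa>) \<le> 2 * ?A x x + 2 * ((norm x)\<^sup>2 / \<kappa>)"
    using \<kappa> by (simp add: y_def dot_square_norm power2_eq_square field_simps)
  then have "(norm x)\<^sup>2 / \<kappa> \<le> ?A x x" by simp
  then have "(norm x)\<^sup>2 \<le> \<kappa> * ?A x x" using \<kappa> by (simp add: field_simps)
  then show ?thesis unfolding \<kappa>_def .
qed

section \<open>Lowering the trace and the defect of idempotency\<close>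

lemma trace_le_reduce:
  \<comment> \<open>The supremum over orthonormal systems may be restricted to those whose span contains the
    vector representing \<open>\<lambda>u. \<Phi>(T u, v)\<close>.\<close>
  fixes Q' :: "'h \<Rightarrow>\<^sub>L 'h"
  assumes "admissible Q" "trace_le Q K" and t: "0 \<le> t"
    and Q': "\<And>x. neg_form Q' x x = neg_form Q x x - t * (J x \<bullet> v)\<^sup>2"
    and pos: "\<And>x. 0 \<le> neg_form Q' x x"
  shows "trace_le Q' (K - t * (norm v)\<^sup>2 / M\<^sup>2)"
  unfolding trace_le_def
proof (intro ballI allI impI)
  fix T and S :: "'h set"
  assume T: "T \<in> \<G>" and S: "finite S" "orthonormal S"
  obtain T' where T': "T' \<in> \<G>" "\<And>x. T (T' x) = x" using inv_in[OF T] by blast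
  define w where "w = J (T' v)"
  obtain S' where S': "S \<subseteq> S'" "finite S'" "orthonormal S'" "w \<in> span S'"
    using orthonormal_extend[OF S] by metis
  have Jw: "J (T u) \<bullet> v = u \<bullet> w" for u
    using isometric2[OF T, of u "T' v"] by (simp add: T' w_def J_sym)
  have "norm v \<le> M * norm w" using norm_apply_le[OF T, of "T' v"] by (simp add: T' w_def)
  then have "(norm v)\<^sup>2 \<le> (M * norm w)\<^sup>2" by (intro power_mono) auto
  then have vw: "(norm v)\<^sup>2 / M\<^sup>2 \<le> (norm w)\<^sup>2"
    using M_ge_1 by (simp add: power_mult_distrib field_simps)
  have "(\<Sum>u\<in>S. neg_form Q' (T u) (T u)) \<le> (\<Sum>u\<in>S'. neg_form Q' (T u) (T u))"
    by (rule sum_mono2) (use S' pos in auto)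
  also have "\<dots> = (\<Sum>u\<in>S'. neg_form Q (T u) (T u)) - t * (norm w)\<^sup>2"
    by (simp add: Q' Jw sum_subtractf sum_distrib_left[symmetric] orthonormal_parseval[OF S'(2-4)])
  also have "\<dots> \<le> K - t * ((norm v)\<^sup>2 / M\<^sup>2)"
    using assms(2) T S' mult_left_mono[OF vw t] unfolding trace_le_def by fastforce
  finally show "(\<Sum>u\<in>S. neg_form Q' (T u) (T u)) \<le> K - t * (norm v)\<^sup>2 / M\<^sup>2" by simp
qed

text \<open>The infimum of F over the admissible operators. The set of bounds is bounded below by 0,
  and it is nonempty because P2 has finite trace.\<close>

definition trace_inf :: real
  where "trace_inf = Inf {K. \<exists>Q. admissible Q \<and> trace_le Q K}"

lemma trace_le_nonneg: "trace_le Q K \<Longrightarrow> 0 \<le> K"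
  using id_in unfolding trace_le_def
  by (metis empty_iff finite.emptyI orthonormal_def pairwise_empty sum.empty)

lemma trace_inf_le: "admissible Q \<Longrightarrow> trace_le Q K \<Longrightarrow> trace_inf \<le> K"
  unfolding trace_inf_def by (rule cInf_lower) (auto intro!: bdd_belowI[of _ 0] dest: trace_le_nonneg)

lemma idempotency_defect:
  \<comment> \<open>The perturbed form is nonnegative since \<open>v = Q (z - Q z)\<close>, and \<open>\<Phi> + b\<close> stays nonnegative since
    also \<open>v = (1 - Q) (Q z)\<close>: both are Cauchy-Schwarz.\<close>
  assumes Q: "admissible Q" "trace_le Q (trace_inf + \<epsilon>)"
  shows "(norm (Q z - Q (Q z)))\<^sup>2 \<le> M ^ 4 * (1 + M\<^sup>2)\<^sup>2 * \<epsilon> * (norm z)\<^sup>2"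
proof (cases "z = 0")
  case False
  \<comment> \<open>A common upper bound for Phi + b at \<open>Q z\<close> and for b at
    \<open>z - Q z\<close>, the factors that the two Cauchy-Schwarz inequalities produce.\<close>
  define c where "c = M\<^sup>2 * (1 + M\<^sup>2)\<^sup>2 * (norm z)\<^sup>2"
  have M2: "1 \<le> M\<^sup>2" using M_ge_1 by simp
  have "0 < 1 + M\<^sup>2" using M2 by simp
  then have c: "c > 0" unfolding c_def using False M_ge_1 by simp
  define v where "v = Q z - Q (Q z)"
  have nQz: "norm (Q z) \<le> M\<^sup>2 * norm z" by (rule admissible_norm_le[OF Q(1)])
  have "J (Q z) \<bullet> Q z + neg_form Q (Q z) (Q z) \<le> (1 + M\<^sup>2) * (norm (Q z))\<^sup>2"
    using form_bound[of "Q z" "Q z"] admissibleD(5)[OF Q(1), of "Q z"]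
    by (simp add: power2_eq_square algebra_simps)
  also have "\<dots> \<le> (1 + M\<^sup>2) * (M\<^sup>2 * norm z)\<^sup>2"
    by (intro mult_left_mono power_mono nQz) auto
  also have "\<dots> \<le> c"
  proof -
    have "(1 + M\<^sup>2) * M\<^sup>2 * (norm z)\<^sup>2 * M\<^sup>2 \<le> (1 + M\<^sup>2) * M\<^sup>2 * (norm z)\<^sup>2 * (1 + M\<^sup>2)"
      by (intro mult_left_mono) auto
    then show ?thesis by (simp add: c_def power2_eq_square mult_ac)
  qed
  finally have c1: "J (Q z) \<bullet> Q z + neg_form Q (Q z) (Q z) \<le> c" .
  have "norm (z - Q z) \<le> (1 + M\<^sup>2) * norm z"
    using norm_triangle_ineq4[of z "Q z"] nQz by (simp add: algebra_simps)
  then have "(norm (z - Q z))\<^sup>2 \<le> ((1 + M\<^sup>2) * norm z)\<^sup>2" by (intro power_mono) auto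
  then have "M\<^sup>2 * (norm (z - Q z))\<^sup>2 \<le> c"
    by (simp add: c_def power_mult_distrib mult.assoc mult_left_mono)
  then have c2: "neg_form Q (z - Q z) (z - Q z) \<le> c"
    using admissibleD(5)[OF Q(1), of "z - Q z"] by simp
  have v1: "J x \<bullet> v = J x \<bullet> Q z + neg_form Q x (Q z)" for x
    using admissibleD(1)[OF Q(1), of x "Q z"] by (simp add: v_def neg_form_def inner_diff_right)
  have v2: "J x \<bullet> v = - neg_form Q x (z - Q z)" for x
    using admissibleD(1)[OF Q(1), of x "z - Q z"]
    by (simp add: v_def neg_form_def blinfun.diff_right)
  \<comment> \<open>The rank-one perturbation whose form is b minus Phi(., v)^2 / c.\<close>
  define Q' where "Q' = Q + Blinfun (\<lambda>x. ((J x \<bullet> v) / c) *\<^sub>R v)"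
  have "bounded_linear (\<lambda>x. ((J x \<bullet> v) / c) *\<^sub>R v)"
    by (intro bounded_linear_scaleR_const bounded_linear_divide[THEN bounded_linear_compose]
        bounded_linear_inner_left[THEN bounded_linear_compose] blinfun.bounded_linear_right)
  then have Q': "Q' x = Q x + ((J x \<bullet> v) / c) *\<^sub>R v" for x
    by (simp add: Q'_def blinfun.add_left bounded_linear_Blinfun_apply)
  have b': "neg_form Q' x x = neg_form Q x x - (1 / c) * (J x \<bullet> v)\<^sup>2" for x
    using form_commute[of x v]
    by (simp add: neg_form_def Q' blinfun.bilinear_simps inner_simps power2_eq_square)
  have pos: "0 \<le> neg_form Q' x x" for x
  proof -
    have "(J x \<bullet> v)\<^sup>2 \<le> neg_form Q x x * c"
      using neg_form_CS[OF Q(1), of x "z - Q z"] mult_left_mono[OF c2 admissibleD(2)[OF Q(1), of x]]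
      by (simp add: v2)
    then show ?thesis using c by (simp add: b' field_simps)
  qed
  have "admissible Q'"
    unfolding admissible_def
  proof (intro conjI allI ballI pos)
    show "J (Q' x) \<bullet> y = J x \<bullet> Q' y" for x y
      using form_commute[of v y] admissibleD(1)[OF Q(1), of x y]
      by (simp add: Q' blinfun.bilinear_simps inner_simps)
    show "0 \<le> J x \<bullet> x + neg_form Q' x x" for x
    proof -
      have "(J x \<bullet> v)\<^sup>2 \<le> (J x \<bullet> x + neg_form Q x x) * c"
        using pos_form_CS[OF Q(1), of x "Q z"] mult_left_mono[OF c1 admissibleD(3)[OF Q(1), of x]]
        by (simp add: v1)
      then show ?thesis using c by (simp add: b' field_simps)
    qed
    show "neg_form Q' (T x) (T x) \<le> M\<^sup>2 * (norm x)\<^sup>2" if "T \<in> \<G>" for T x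
    proof -
      have "neg_form Q' (T x) (T x) \<le> neg_form Q (T x) (T x)" using c by (simp add: b')
      then show ?thesis using admissibleD(4)[OF Q(1) that, of x] by linarith
    qed
  qed
  moreover have "trace_le Q' (trace_inf + \<epsilon> - (1 / c) * (norm v)\<^sup>2 / M\<^sup>2)"
    by (rule trace_le_reduce[OF Q _ b' pos]) (use c in auto)
  \<comment> \<open>The perturbed operator cannot fall below the infimum, so the decrease of the
    bound is at most \<epsilon>.\<close>
  ultimately have "trace_inf \<le> trace_inf + \<epsilon> - (1 / c) * (norm v)\<^sup>2 / M\<^sup>2"
    by (rule trace_inf_le)
  then have "(norm v)\<^sup>2 / (c * M\<^sup>2) \<le> \<epsilon>" by simp
  then have "(norm v)\<^sup>2 \<le> \<epsilon> * (c * M\<^sup>2)"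
    using c M_ge_1 by (subst (asm) pos_divide_le_eq) auto
  also have "\<dots> = M ^ 4 * (1 + M\<^sup>2)\<^sup>2 * \<epsilon> * (norm z)\<^sup>2"
    by (simp add: c_def power4_eq_xxxx power2_eq_square mult_ac)
  finally show ?thesis unfolding v_def .
qed simp


section \<open>Convexity and invariance under conjugation\<close>

lemma neg_form_average:
  "neg_form ((1 / 2) *\<^sub>R (Q + Q')) x y = 1 / 2 * neg_form Q x y + 1 / 2 * neg_form Q' x y"
  by (simp add: neg_form_def blinfun.scaleR_left blinfun.add_left blinfun.scaleR_right
      blinfun.add_right inner_add_left field_simps)

lemma admissible_average:
  assumes "admissible Q" "admissible Q'"
  shows "admissible ((1 / 2) *\<^sub>R (Q + Q'))"
  unfolding admissible_def
proof (intro conjI allI ballI)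
  fix x y
  show "J (((1 / 2) *\<^sub>R (Q + Q')) x) \<bullet> y = J x \<bullet> ((1 / 2) *\<^sub>R (Q + Q')) y"
    using admissibleD(1)[OF assms(1), of x y] admissibleD(1)[OF assms(2), of x y]
    by (simp add: blinfun.bilinear_simps inner_simps)
  show "0 \<le> neg_form ((1 / 2) *\<^sub>R (Q + Q')) x x"
    using admissibleD(2)[OF assms(1), of x] admissibleD(2)[OF assms(2), of x]
    unfolding neg_form_average by linarith
  show "0 \<le> J x \<bullet> x + neg_form ((1 / 2) *\<^sub>R (Q + Q')) x x"
    using admissibleD(3)[OF assms(1), of x] admissibleD(3)[OF assms(2), of x]
    unfolding neg_form_average by linarith
  fix T assume "T \<in> \<G>"
  then show "neg_form ((1 / 2) *\<^sub>R (Q + Q')) (T x) (T x) \<le> M\<^sup>2 * (norm x)\<^sup>2"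
    using admissibleD(4)[OF assms(1), of T x] admissibleD(4)[OF assms(2), of T x]
    unfolding neg_form_average by linarith
qed

lemma trace_le_average:
  assumes "trace_le Q K" "trace_le Q' K"
  shows "trace_le ((1 / 2) *\<^sub>R (Q + Q')) K"
  unfolding trace_le_def
proof (intro ballI allI impI)
  fix T and S :: "'h set"
  assume "T \<in> \<G>" "finite S" "orthonormal S"
  then have "(\<Sum>u\<in>S. neg_form Q (T u) (T u)) \<le> K" "(\<Sum>u\<in>S. neg_form Q' (T u) (T u)) \<le> K"
    using assms by (auto simp: trace_le_def)
  then show "(\<Sum>u\<in>S. neg_form ((1 / 2) *\<^sub>R (Q + Q')) (T u) (T u)) \<le> K"
    by (simp add: neg_form_average sum.distrib sum_distrib_left[symmetric] sum_divide_distrib[symmetric])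
qed

text \<open>Apply the isometry \<open>T\<close> to both arguments of Phi(T'QTx, y); the right
  inverse then cancels.\<close>

lemma neg_form_conj:
  fixes T' :: "'h \<Rightarrow>\<^sub>L 'h"
  assumes "T \<in> \<G>" "\<And>x. T (T' x) = x"
  shows "neg_form (T' o\<^sub>L Q o\<^sub>L T) x y = neg_form Q (T x) (T y)"
  using isometric2[OF assms(1), of "T' (Q (T x))" y] by (simp add: neg_form_def assms(2))

lemma admissible_conj:
  fixes T' :: "'h \<Rightarrow>\<^sub>L 'h"
  assumes Q: "admissible Q" and T: "T \<in> \<G>" "\<And>x. T (T' x) = x"
  shows "admissible (T' o\<^sub>L Q o\<^sub>L T)"
  unfolding admissible_def
proof (intro conjI allI ballI)
  note conj = neg_form_conj[OF T]
  fix x y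
  show "J ((T' o\<^sub>L Q o\<^sub>L T) x) \<bullet> y = J x \<bullet> (T' o\<^sub>L Q o\<^sub>L T) y"
    using conj[of Q x y] conj[of Q y x] neg_form_commute[OF Q, of "T x" "T y"]
      form_commute[of x "(T' o\<^sub>L Q o\<^sub>L T) y"]
    by (simp add: neg_form_def)
  show "0 \<le> neg_form (T' o\<^sub>L Q o\<^sub>L T) x x"
    by (simp add: conj admissibleD(2)[OF Q])
  show "0 \<le> J x \<bullet> x + neg_form (T' o\<^sub>L Q o\<^sub>L T) x x"
    using admissibleD(3)[OF Q, of "T x"] by (simp add: conj isometric[OF T(1)])
  fix R assume "R \<in> \<G>"
  then show "neg_form (T' o\<^sub>L Q o\<^sub>L T) (R x) (R x) \<le> M\<^sup>2 * (norm x)\<^sup>2"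
    using admissibleD(4)[OF Q comp_in[OF T(1)], of R x] by (simp add: conj)
qed

lemma trace_le_conj:
  fixes T' :: "'h \<Rightarrow>\<^sub>L 'h"
  assumes Q: "trace_le Q K" and T: "T \<in> \<G>" "\<And>x. T (T' x) = x"
  shows "trace_le (T' o\<^sub>L Q o\<^sub>L T) K"
  unfolding trace_le_def
proof (intro ballI allI impI)
  fix R and S :: "'h set"
  assume "R \<in> \<G>" "finite S" "orthonormal S"
  then have "(\<Sum>u\<in>S. neg_form Q ((T o\<^sub>L R) u) ((T o\<^sub>L R) u)) \<le> K"
    using Q comp_in[OF T(1)] unfolding trace_le_def by blast
  then show "(\<Sum>u\<in>S. neg_form (T' o\<^sub>L Q o\<^sub>L T) (R u) (R u)) \<le> K"
    by (simp add: neg_form_conj[OF T])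
qed

section \<open>Distance between almost idempotent operators\<close>

text \<open>The vector u = (1 - Q')Qz is small because the majorant Phi + 2b' of \<open>Q'\<close>
  is small there. The b' part is small since Q'u is a defect of \<open>Q'\<close>; up to a defect of
  \<open>Q\<close>, Phi(u) equals Phi(D^2 w, w) with w = Qz and D = Q - Q', and D^2 is a combination
  of defects.\<close>

lemma almost_projections_close_step:
  assumes Q: "admissible Q" and Q': "admissible Q'" and \<eta>: "0 \<le> \<eta>" "\<eta> \<le> 1"
    and defect: "\<And>z. norm (Q z - Q (Q z)) \<le> \<eta> * norm z"
    and defect': "\<And>z. norm (Q' z - Q' (Q' z)) \<le> \<eta> * norm z"
    and defect_avg: "\<And>z. norm (((1 / 2) *\<^sub>R (Q + Q')) z
        - ((1 / 2) *\<^sub>R (Q + Q')) (((1 / 2) *\<^sub>R (Q + Q')) z)) \<le> \<eta> * norm z"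
  shows "(norm (Q z - Q' (Q z)))\<^sup>2 \<le> 17 * (2 * M\<^sup>2 + 1) * (M\<^sup>2) ^ 3 * \<eta> * (norm z)\<^sup>2"
proof -
  define m where "m = M\<^sup>2"
  define a where "a = norm z"
  define w where "w = Q z"
  define D where "D = Q - Q'"
  define r where "r = w - Q w"
  define u where "u = w - Q' w"
  have m1: "1 \<le> m" using M_ge_1 by (simp add: m_def)
  have a0: "0 \<le> a" by (simp add: a_def)
  have nQ: "norm (Q x) \<le> m * norm x" "norm (Q' x) \<le> m * norm x" for x
    using admissible_norm_le[OF Q] admissible_norm_le[OF Q'] by (auto simp: m_def)
  have w: "norm w \<le> m * a" using nQ by (simp add: w_def a_def)
  have mw: "m * norm w \<le> m\<^sup>2 * a"
    using mult_left_mono[OF w, of m] m1 by (simp add: power2_eq_square mult.assoc)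
  have r: "norm r \<le> \<eta> * a" using defect[of z] by (simp add: r_def w_def a_def)
  have Dw: "norm (D w) \<le> 2 * m\<^sup>2 * a"
    using norm_triangle_ineq4[of "Q w" "Q' w"] nQ[of w] mw by (simp add: D_def blinfun.diff_left)
  \<comment> \<open>With R the average, (Q - Q')^2 = 4(R - R^2) - 2(Q - Q^2) - 2(Q' - Q'^2); no
    commutation is involved.\<close>
  have "D (D w) = 4 *\<^sub>R (((1 / 2) *\<^sub>R (Q + Q')) w - ((1 / 2) *\<^sub>R (Q + Q')) (((1 / 2) *\<^sub>R (Q + Q')) w))
      - 2 *\<^sub>R (Q w - Q (Q w)) - 2 *\<^sub>R (Q' w - Q' (Q' w))" (is "_ = 4 *\<^sub>R ?x - 2 *\<^sub>R ?y - 2 *\<^sub>R ?z")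
  proof -
    have "4 *\<^sub>R ?x = 2 *\<^sub>R (Q w + Q' w) - (Q (Q w) + Q (Q' w) + Q' (Q w) + Q' (Q' w))"
      by (simp add: blinfun.add_left blinfun.add_right blinfun.scaleR_left blinfun.scaleR_right
          scaleR_diff_right scaleR_add_right)
    then show ?thesis
      by (simp add: D_def blinfun.diff_left blinfun.diff_right scaleR_diff_right scaleR_add_right
          scaleR_2)
  qed
  then have "norm (D (D w)) \<le> norm (4 *\<^sub>R ?x) + norm (2 *\<^sub>R ?y) + norm (2 *\<^sub>R ?z)"
    by (simp only: norm_diff_diff_le)
  also have "\<dots> \<le> 8 * \<eta> * norm w"
    using defect[of w] defect'[of w] defect_avg[of w] by simp
  also have "\<dots> \<le> 8 * \<eta> * (m * a)" using w \<eta> by (intro mult_left_mono) auto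
  finally have DDw: "norm (D (D w)) \<le> 8 * \<eta> * (m * a)" .
  have "J (D w) \<bullet> D w = J (D (D w)) \<bullet> w"
    using admissibleD(1)[OF Q, of "D w" w] admissibleD(1)[OF Q', of "D w" w]
    by (simp add: D_def blinfun.bilinear_simps inner_simps)
  then have p1: "J (D w) \<bullet> D w \<le> 8 * \<eta> * (m * a) * (m * a)"
    using form_bound[of "D (D w)" w] mult_mono[OF DDw w] \<eta> m1 a0 by (simp add: abs_le_iff)
  have p2: "J (D w) \<bullet> r \<le> 2 * m\<^sup>2 * a * (\<eta> * a)"
    using form_bound[of "D w" r] mult_mono[OF Dw r] \<eta> m1 a0 by (simp add: abs_le_iff)
  have p3: "J r \<bullet> r \<le> \<eta> * a * (\<eta> * a)"
    using form_bound[of r r] mult_mono[OF r r] \<eta> m1 a0 by (simp add: abs_le_iff)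
  have u_eq: "u = D w + r" by (simp add: u_def D_def r_def blinfun.diff_left)
  have "J u \<bullet> u = J (D w) \<bullet> D w + 2 * (J (D w) \<bullet> r) + J r \<bullet> r"
    using form_commute[of "D w" r] by (simp add: u_eq blinfun.add_right inner_simps)
  then have p4: "J u \<bullet> u \<le> (8 * m\<^sup>2 * \<eta> + 4 * m\<^sup>2 * \<eta> + \<eta>\<^sup>2) * a\<^sup>2"
    using p1 p2 p3 by (simp add: power2_eq_square algebra_simps)
  have "norm (Q' u) \<le> \<eta> * norm w" using defect'[of w] by (simp add: u_def blinfun.diff_right)
  also have "\<dots> \<le> \<eta> * (m * a)" by (intro mult_left_mono w \<eta>)
  finally have Q'u: "norm (Q' u) \<le> \<eta> * (m * a)" .
  have "m \<le> m\<^sup>2" using m1 by (simp add: power2_eq_square)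
  then have "m * a \<le> m\<^sup>2 * a" using a0 by (rule mult_right_mono)
  then have nu: "norm u \<le> 2 * m\<^sup>2 * a"
    using norm_triangle_ineq4[of w "Q' w"] nQ(2)[of w] mw w by (simp add: u_def)
  have "neg_form Q' u u \<le> norm (Q' u) * norm u"
    using form_bound[of "Q' u" u] by (simp add: neg_form_def abs_le_iff)
  also have "\<dots> \<le> \<eta> * (m * a) * (2 * m\<^sup>2 * a)"
    using \<eta> m1 a0 by (intro mult_mono Q'u nu) auto
  also have "\<dots> = 2 * m ^ 3 * \<eta> * a\<^sup>2" by (simp add: power2_eq_square power3_eq_cube)
  finally have p5: "neg_form Q' u u \<le> 2 * m ^ 3 * \<eta> * a\<^sup>2" .
  \<comment> \<open>All terms are absorbed into m^3 \<eta>, using 1 \<le> m and \<eta> \<le> 1. The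
    coefficients are 8 + 4 + 1 = 13 from Phi(u) and 2 * 2 from twice b'(u), in total 17.\<close>
  have "m\<^sup>2 * \<eta> \<le> m ^ 3 * \<eta>" using m1 \<eta> by (intro mult_right_mono power_increasing) auto
  moreover have "\<eta>\<^sup>2 \<le> m ^ 3 * \<eta>"
    using mult_mono[of \<eta> "m ^ 3" \<eta> \<eta>] \<eta> m1 one_le_power[OF m1, of 3] by (simp add: power2_eq_square)
  ultimately have "8 * m\<^sup>2 * \<eta> + 4 * m\<^sup>2 * \<eta> + \<eta>\<^sup>2 \<le> 13 * m ^ 3 * \<eta>" by linarith
  from mult_right_mono[OF this, of "a\<^sup>2"] p4 p5
  have "J u \<bullet> u + 2 * neg_form Q' u u \<le> 17 * m ^ 3 * \<eta> * a\<^sup>2" by simp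
  then have "(2 * m + 1) * (J u \<bullet> u + 2 * neg_form Q' u u) \<le> (2 * m + 1) * (17 * m ^ 3 * \<eta> * a\<^sup>2)"
    using m1 by (intro mult_left_mono) auto
  with majorant_lower_bound[OF Q', of u]
  have "(norm u)\<^sup>2 \<le> (2 * m + 1) * (17 * m ^ 3 * \<eta> * a\<^sup>2)"
    unfolding m_def by linarith
  also have "\<dots> = 17 * (2 * m + 1) * m ^ 3 * \<eta> * a\<^sup>2" by (simp only: mult_ac)
  finally show ?thesis unfolding m_def u_def w_def a_def .
qed

text \<open>Write Q - Q' = (Q - Q'Q) - (Q' - Q'Q). The first term is bounded by the preceding
  estimate; the second is the Phi-adjoint of Q' - QQ', bounded by the same estimate with the roles
  exchanged.\<close>

lemma almost_projections_close:
  assumes Q: "admissible Q" and Q': "admissible Q'" and \<eta>: "0 \<le> \<eta>" "\<eta> \<le> 1"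
    and defect: "\<And>z. norm (Q z - Q (Q z)) \<le> \<eta> * norm z"
    and defect': "\<And>z. norm (Q' z - Q' (Q' z)) \<le> \<eta> * norm z"
    and defect_avg: "\<And>z. norm (((1 / 2) *\<^sub>R (Q + Q')) z
        - ((1 / 2) *\<^sub>R (Q + Q')) (((1 / 2) *\<^sub>R (Q + Q')) z)) \<le> \<eta> * norm z"
  shows "norm (Q - Q') \<le> 2 * sqrt (17 * (2 * M\<^sup>2 + 1) * (M\<^sup>2) ^ 3 * \<eta>)"
proof (rule norm_blinfun_bound)
  define \<delta> where "\<delta> = sqrt (17 * (2 * M\<^sup>2 + 1) * (M\<^sup>2) ^ 3 * \<eta>)"
  have step: "norm x \<le> \<delta> * norm z"
    if "(norm x)\<^sup>2 \<le> 17 * (2 * M\<^sup>2 + 1) * (M\<^sup>2) ^ 3 * \<eta> * (norm z)\<^sup>2" for x z :: 'h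
    using real_le_rsqrt[OF that] by (simp add: \<delta>_def real_sqrt_mult)
  have s1: "norm (Q z - Q' (Q z)) \<le> \<delta> * norm z" for z
    by (rule step[OF almost_projections_close_step[OF assms]])
  have s2: "norm (Q' z - Q (Q' z)) \<le> \<delta> * norm z" for z
    by (rule step[OF almost_projections_close_step[OF Q' Q \<eta> defect' defect]])
      (use defect_avg in \<open>simp add: add.commute\<close>)
  fix z
  define e where "e = (Q - Q') z"
  \<comment> \<open>Testing Phi(e, .) against \<open>J e\<close> recovers the squared norm of
    \<open>e\<close>.\<close>
  define y where "y = J e"
  have "(norm e)\<^sup>2 = J e \<bullet> y" by (simp add: y_def dot_square_norm)
  also have "\<dots> = J (Q z - Q' (Q z)) \<bullet> y - J z \<bullet> (Q' y - Q (Q' y))"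
    using admissibleD(1)[OF Q', of "Q z" y] admissibleD(1)[OF Q', of z y]
      admissibleD(1)[OF Q, of z "Q' y"]
    by (simp add: e_def blinfun.bilinear_simps inner_simps)
  also have "\<dots> \<le> \<delta> * norm z * norm y + norm z * (\<delta> * norm y)"
    using form_bound[of "Q z - Q' (Q z)" y] form_bound[of z "Q' y - Q (Q' y)"]
      mult_right_mono[OF s1[of z] norm_ge_zero[of y]] mult_left_mono[OF s2[of y] norm_ge_zero[of z]]
    by linarith
  finally have "norm e * norm e \<le> (2 * \<delta> * norm z) * norm e"
    by (simp add: y_def power2_eq_square algebra_simps)
  then have "norm e \<le> 2 * \<delta> * norm z"
    by (cases "e = 0") (use \<eta> in \<open>auto simp: \<delta>_def\<close>)
  then show "norm ((Q - Q') z) \<le> 2 * sqrt (17 * (2 * M\<^sup>2 + 1) * (M\<^sup>2) ^ 3 * \<eta>) * norm z"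
    by (simp add: e_def \<delta>_def)
qed (use \<eta> in auto)

section \<open>Existence and closeness of near-minimisers\<close>

text \<open>This \<open>Q\<close> is P2, with b(x) = |P2 x|^2. Finiteness of the negative part
  enters here: by Parseval the trace along \<open>T\<close> is a sum over a finite orthonormal
  system \<open>E\<close>, and Bessel bounds the contribution of each element of \<open>E\<close> by
  \<open>M\<^sup>2\<close>.\<close>

lemma half_minus_J_admissible:
  defines "Q \<equiv> (1 / 2) *\<^sub>R (id_blinfun - J)"
  shows "admissible Q" "\<exists>K. trace_le Q K"
proof -
  have Q: "Q x = (1 / 2) *\<^sub>R (x - J x)" for x
    by (simp add: Q_def blinfun.scaleR_left blinfun.diff_left)
  have JQ: "J (Q x) = - Q x" for x
    by (simp add: Q blinfun.scaleR_right blinfun.diff_right algebra_simps)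
  have Q_Q: "Q (Q x) = Q x" for x
    unfolding Q[of "Q x"] by (simp add: JQ flip: scaleR_2)
  have sym: "Q x \<bullet> y = x \<bullet> Q y" for x y
    by (simp add: Q inner_diff_left inner_diff_right J_sym)
  have form: "neg_form Q x y = Q x \<bullet> Q y" for x y
    using sym[of "Q x" y] by (simp add: neg_form_def JQ Q_Q)
  have norm_Q: "norm (Q x) \<le> norm x" for x
    using norm_triangle_ineq4[of x "J x"] by (simp add: Q)
  show "admissible Q"
    unfolding admissible_def
  proof (intro conjI allI ballI)
    fix x y
    show "J (Q x) \<bullet> y = J x \<bullet> Q y"
      using sym[of x y] sym[of "J x" y] J_sym[of x "Q y"] by (simp add: JQ)
    show "0 \<le> neg_form Q x x" by (simp add: form)
    have "J x = x - 2 *\<^sub>R Q x" by (simp add: Q)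
    then have "J x \<bullet> x + neg_form Q x x = (x - Q x) \<bullet> (x - Q x)"
      using sym[of "Q x" x] sym[of x x]
      by (simp add: form inner_simps Q_Q)
    then show "0 \<le> J x \<bullet> x + neg_form Q x x" by simp
    fix T assume "T \<in> \<G>"
    have "norm (Q (T x)) \<le> M * norm x"
      using norm_Q[of "T x"] norm_apply_le[OF \<open>T \<in> \<G>\<close>, of x] by linarith
    then have "(norm (Q (T x)))\<^sup>2 \<le> (M * norm x)\<^sup>2" by (intro power_mono) auto
    then show "neg_form Q (T x) (T x) \<le> M\<^sup>2 * (norm x)\<^sup>2"
      by (simp add: form dot_square_norm power_mult_distrib)
  qed
  obtain C where C: "finite C" "\<And>x. x - J x \<in> span C" using finite_negative by blast
  obtain E where E: "finite E" "orthonormal E" "C \<subseteq> span E"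
    using finite_orthonormal_spanning[OF C(1)] .
  have "span C \<subseteq> span E" using E(3) by (rule span_minimal) (rule subspace_span)
  then have QE: "Q x \<in> span E" for x
    unfolding Q by (intro span_scale) (use C(2) in auto)
  have "trace_le Q (real (card E) * M\<^sup>2)"
    unfolding trace_le_def
  proof (intro ballI allI impI)
    fix T and S :: "'h set"
    assume T: "T \<in> \<G>" and S: "finite S" "orthonormal S"
    have "(\<Sum>u\<in>S. neg_form Q (T u) (T u)) = (\<Sum>u\<in>S. \<Sum>e\<in>E. (e \<bullet> Q (T u))\<^sup>2)"
      by (simp add: form orthonormal_parseval[OF E(1,2) QE] dot_square_norm)
    also have "\<dots> = (\<Sum>e\<in>E. \<Sum>u\<in>S. (e \<bullet> Q (T u))\<^sup>2)" by (rule sum.swap)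
    also have "\<dots> \<le> (\<Sum>e\<in>E. M\<^sup>2)"
    proof (rule sum_mono)
      fix e assume "e \<in> E"
      then have e: "norm e = 1" using E(2) by (simp add: orthonormal_def)
      show "(\<Sum>u\<in>S. (e \<bullet> Q (T u))\<^sup>2) \<le> M\<^sup>2"
      proof (rule orthonormal_bessel[OF S])
        show "linear (\<lambda>u. e \<bullet> Q (T u))"
          by (rule linearI) (simp_all add: blinfun.bilinear_simps inner_simps)
        show "\<bar>e \<bullet> Q (T x)\<bar> \<le> M * norm x" for x
          using Cauchy_Schwarz_ineq2[of e "Q (T x)"] norm_Q[of "T x"] norm_apply_le[OF T, of x] e
          by simp
      qed
    qed
    finally show "(\<Sum>u\<in>S. neg_form Q (T u) (T u)) \<le> real (card E) * M\<^sup>2" by simp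
  qed
  then show "\<exists>K. trace_le Q K" by blast
qed

lemma near_minimiser_exists:
  assumes "0 < \<epsilon>"
  shows "\<exists>Q. admissible Q \<and> trace_le Q (trace_inf + \<epsilon>)"
proof -
  have "{K. \<exists>Q. admissible Q \<and> trace_le Q K} \<noteq> {}" using half_minus_J_admissible by blast
  from cInf_lessD[OF this, of "trace_inf + \<epsilon>"] assms
  obtain K Q where "admissible Q" "trace_le Q K" "K < trace_inf + \<epsilon>"
    by (auto simp: trace_inf_def)
  then show ?thesis unfolding trace_le_def by (meson less_imp_le order_trans)
qed

text \<open>The excess over the infimum for which the bound on the defect of idempotency becomes
  exactly \<eta>.\<close>

definition tolerance :: "real \<Rightarrow> real"
  where "tolerance \<eta> = \<eta>\<^sup>2 / (M ^ 4 * (1 + M\<^sup>2)\<^sup>2)"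

lemma tolerance_pos: "0 < \<eta> \<Longrightarrow> 0 < tolerance \<eta>"
proof -
  have "0 < 1 + M\<^sup>2" by (intro add_pos_nonneg) auto
  then show "0 < \<eta> \<Longrightarrow> 0 < tolerance \<eta>" using M_ge_1 by (simp add: tolerance_def)
qed

lemma near_minimiser_defect:
  assumes "admissible Q" "trace_le Q (trace_inf + tolerance \<eta>)" "0 \<le> \<eta>"
  shows "norm (Q z - Q (Q z)) \<le> \<eta> * norm z"
proof -
  have "0 < 1 + M\<^sup>2" by (intro add_pos_nonneg) auto
  then have "M ^ 4 * (1 + M\<^sup>2)\<^sup>2 * tolerance \<eta> = \<eta>\<^sup>2" using M_ge_1 by (simp add: tolerance_def)
  then have "(norm (Q z - Q (Q z)))\<^sup>2 \<le> (\<eta> * norm z)\<^sup>2"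
    using idempotency_defect[OF assms(1,2), of z] by (simp add: power_mult_distrib)
  then show ?thesis by (rule power2_le_imp_le) (use assms(3) in simp)
qed

text \<open>By convexity the average is a near-minimiser too, so all three defects are at most
  \<eta>.\<close>

lemma near_minimisers_close:
  assumes "admissible Q" "trace_le Q (trace_inf + tolerance \<eta>)"
    and "admissible Q'" "trace_le Q' (trace_inf + tolerance \<eta>)" and "0 \<le> \<eta>" "\<eta> \<le> 1"
  shows "norm (Q - Q') \<le> 2 * sqrt (17 * (2 * M\<^sup>2 + 1) * (M\<^sup>2) ^ 3 * \<eta>)"
  using assms
  by (intro almost_projections_close near_minimiser_defect admissible_average trace_le_average)

section \<open>The invariant projection as a limit of near-minimisers\<close>

theorem invariant_projection:
  obtains P where "admissible P" "\<And>x. P (P x) = P x" "\<And>T x. T \<in> \<G> \<Longrightarrow> P (T x) = T (P x)"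
proof -
  define \<eta> where "\<eta> n = 1 / (1 + real n)" for n
  define C where "C = 17 * (2 * M\<^sup>2 + 1) * (M\<^sup>2) ^ 3"
  define err where "err n = 2 * sqrt (C * \<eta> n)" for n
  have \<eta>: "0 < \<eta> n" "\<eta> n \<le> 1" for n by (auto simp: \<eta>_def)
  have \<eta>_mono: "\<eta> m \<le> \<eta> n" if "n \<le> m" for m n using that by (auto simp: \<eta>_def frac_le)
  have \<eta>_lim: "\<eta> \<longlonglongrightarrow> 0"
    unfolding \<eta>_def using LIMSEQ_inverse_real_of_nat by (simp add: inverse_eq_divide add.commute)
  have err_lim: "err \<longlonglongrightarrow> 0"
    unfolding err_def using tendsto_mult[OF tendsto_const tendsto_real_sqrt[OF tendsto_mult[OF tendsto_const \<eta>_lim]], of 2 C]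
    by simp
  obtain Q where Q: "\<And>n. admissible (Q n)" "\<And>n. trace_le (Q n) (trace_inf + tolerance (\<eta> n))"
    using near_minimiser_exists[OF tolerance_pos[OF \<eta>(1)]] by metis
  have tol_mono: "tolerance (\<eta> m) \<le> tolerance (\<eta> n)" if "n \<le> m" for m n
    unfolding tolerance_def using \<eta>_mono[OF that] \<eta>(1)[of m]
    by (intro divide_right_mono power_mono) auto
  \<comment> \<open>Later terms also meet the tolerance of index \<open>n\<close>, so
    \<open>close\<close> compares them with \<open>Q n\<close>; this makes the sequence
    Cauchy.\<close>
  have Q_later: "trace_le (Q m) (trace_inf + tolerance (\<eta> n))" if "n \<le> m" for m n
    using Q(2)[of m] tol_mono[OF that] unfolding trace_le_def by (meson add_left_mono order_trans)
  have close: "norm (Q n - R) \<le> err n"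
    if "admissible R" "trace_le R (trace_inf + tolerance (\<eta> n))" for n R
    unfolding err_def C_def using near_minimisers_close[OF Q that] \<eta>[of n] by simp
  have "Cauchy Q"
    unfolding Cauchy_altdef2
  proof (intro allI impI)
    fix e :: real assume "0 < e"
    then obtain N where "\<bar>err N\<bar> < e"
      using LIMSEQ_D[OF err_lim \<open>0 < e\<close>] by auto
    then have "dist (Q n) (Q N) < e" if "n \<ge> N" for n
      using close[OF Q(1) Q_later[OF that]] by (simp add: dist_norm norm_minus_commute)
    then show "\<exists>N. \<forall>n\<ge>N. dist (Q n) (Q N) < e" by blast
  qed
  then obtain P where P: "Q \<longlonglongrightarrow> P" using Cauchy_convergent convergent_def by blast
  have lim: "(\<lambda>n. Q n x) \<longlonglongrightarrow> P x" for x
    by (intro blinfun.tendsto P tendsto_const)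
  have lim_J: "(\<lambda>n. J (Q n x)) \<longlonglongrightarrow> J (P x)" for x
    by (intro blinfun.tendsto lim tendsto_const)
  have lim_form: "(\<lambda>n. neg_form (Q n) x y) \<longlonglongrightarrow> neg_form P x y" for x y
    unfolding neg_form_def by (intro tendsto_intros lim_J)
  have "admissible P"
    unfolding admissible_def
  proof (intro conjI allI ballI)
    fix x y
    show "J (P x) \<bullet> y = J x \<bullet> P y"
    proof (rule LIMSEQ_unique)
      show "(\<lambda>n. J (Q n x) \<bullet> y) \<longlonglongrightarrow> J (P x) \<bullet> y" by (intro tendsto_intros lim_J)
      show "(\<lambda>n. J (Q n x) \<bullet> y) \<longlonglongrightarrow> J x \<bullet> P y"
        unfolding admissibleD(1)[OF Q(1)] by (intro tendsto_intros lim)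
    qed
    show "0 \<le> neg_form P x x"
      by (rule LIMSEQ_le_const[OF lim_form]) (use admissibleD(2)[OF Q(1)] in auto)
    show "0 \<le> J x \<bullet> x + neg_form P x x"
      by (rule LIMSEQ_le_const[OF tendsto_add[OF tendsto_const lim_form]])
        (use admissibleD(3)[OF Q(1)] in auto)
    show "neg_form P (T x) (T x) \<le> M\<^sup>2 * (norm x)\<^sup>2" if "T \<in> \<G>" for T
      by (rule LIMSEQ_le_const2[OF lim_form]) (use admissibleD(4)[OF Q(1) that] in auto)
  qed
  moreover have "P (P x) = P x" for x
  proof -
    have "(\<lambda>n. Q n x - Q n (Q n x)) \<longlonglongrightarrow> 0"
    proof (rule Lim_null_comparison)
      show "\<forall>\<^sub>F n in sequentially. norm (Q n x - Q n (Q n x)) \<le> \<eta> n * norm x"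
        using near_minimiser_defect[OF Q] \<eta>(1) by (simp add: less_imp_le)
      show "(\<lambda>n. \<eta> n * norm x) \<longlonglongrightarrow> 0" using \<eta>_lim by (rule tendsto_mult_left_zero)
    qed
    moreover have "(\<lambda>n. Q n x - Q n (Q n x)) \<longlonglongrightarrow> P x - P (P x)"
      by (intro tendsto_diff lim blinfun.tendsto P)
    ultimately have "P x - P (P x) = 0" using LIMSEQ_unique by blast
    then show ?thesis by simp
  qed
  moreover have "P (T x) = T (P x)" if T: "T \<in> \<G>" for T x
  proof -
    obtain T' where T': "T' \<in> \<G>" "\<And>x. T (T' x) = x" using inv_in[OF T] by blast
    \<comment> \<open>The conjugate of \<open>Q n\<close> is a near-minimiser of the same tolerance,
      hence within \<open>err n\<close> of \<open>Q n\<close>; in the limit P is fixed by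
      conjugation.\<close>
    have "(\<lambda>n. Q n - (T' o\<^sub>L Q n o\<^sub>L T)) \<longlonglongrightarrow> 0"
      by (rule Lim_null_comparison[OF _ err_lim])
        (intro always_eventually allI close admissible_conj trace_le_conj Q T T')
    then have "(\<lambda>n. (Q n - (T' o\<^sub>L Q n o\<^sub>L T)) x) \<longlonglongrightarrow> 0"
      using blinfun.tendsto[OF _ tendsto_const] by fastforce
    then have "(\<lambda>n. Q n x - T' (Q n (T x))) \<longlonglongrightarrow> 0"
      by (simp add: blinfun.diff_left)
    moreover have "(\<lambda>n. Q n x - T' (Q n (T x))) \<longlonglongrightarrow> P x - T' (P (T x))"
      by (intro tendsto_diff lim blinfun.tendsto tendsto_const)
    ultimately have "P x - T' (P (T x)) = 0" using LIMSEQ_unique by blast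
    then have "T (P x) = T (T' (P (T x)))" by simp
    then show ?thesis by (simp add: T')
  qed
  ultimately show thesis using that by blast
qed

end

section \<open>Passage between real and complex scalars\<close>

instance complex_hilbert \<subseteq> banach ..

lemma cinner_scaleC_right: "cinner x (a *\<^sub>C y) = cnj a * cinner x y"
  by (metis cinner_commute cinner_scaleC_left complex_cnj_mult)

lemma inner_scaleC_scaleC: "(a *\<^sub>C x) \<bullet> (a *\<^sub>C y) = (cmod a)\<^sup>2 * (x \<bullet> y)"
proof -
  have "cinner (a *\<^sub>C x) (a *\<^sub>C y) = complex_of_real ((cmod a)\<^sup>2) * cinner x y"
    by (simp add: cinner_scaleC_left cinner_scaleC_right complex_norm_square del: of_real_power)
  then show ?thesis by (simp add: inner_eq_Re_cinner del: of_real_power)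
qed

lemma norm_scaleC [simp]: "norm (a *\<^sub>C x) = cmod a * norm x"
  by (simp add: norm_eq_sqrt_inner inner_scaleC_scaleC real_sqrt_mult)

lemma scaleC_scaleR: "a *\<^sub>C r *\<^sub>R x = r *\<^sub>R a *\<^sub>C x"
  by (metis mult.commute scaleC_of_real scaleC_scaleC)

lemma bounded_linear_scaleC: "bounded_linear (\<lambda>x. a *\<^sub>C x)"
  by (rule bounded_linear_intro[of _ "cmod a"])
    (simp_all add: scaleC_add_right scaleC_scaleR mult.commute)

text \<open>Conjugate linearity in the second argument turns the imaginary part into a real inner
  product with \<open>\<i> *\<^sub>C y\<close>. Thus invariance of the real inner product suffices
  for complex linear operators.\<close>

lemma cinner_eq_inner: "cinner x y = Complex (x \<bullet> y) (x \<bullet> (\<i> *\<^sub>C y))"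
  by (simp add: complex_eq_iff inner_eq_Re_cinner cinner_scaleC_right)

text \<open>Split a = |a| sgn a; real linearity takes care of the factor |a|.\<close>

lemma complex_linear_of_unimodular:
  assumes "\<And>a x. cmod a = 1 \<Longrightarrow> blinfun_apply P (a *\<^sub>C x) = a *\<^sub>C P x"
  shows "complex_linear P"
  unfolding complex_linear_def
proof (intro allI)
  fix a x
  show "P (a *\<^sub>C x) = a *\<^sub>C P x"
  proof (cases "a = 0")
    case False
    have a: "a *\<^sub>C y = cmod a *\<^sub>R sgn a *\<^sub>C y" for y :: 'a
      using False by (simp add: scaleC_of_real[symmetric] scaleC_scaleC sgn_eq)
    have "P (sgn a *\<^sub>C x) = sgn a *\<^sub>C P x" using False by (intro assms) (simp add: norm_sgn)
    then show ?thesis by (simp add: a blinfun.scaleR_right)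
  qed simp
qed

text \<open>The real span of B and iB is closed under multiplication by i, because i(ib) = -b. This
  turns complex finite-dimensionality into the real spanning condition of the locale.\<close>

lemma complex_span_subset_real_span:
  "complex_vector.span B \<subseteq> span (B \<union> (\<lambda>x. \<i> *\<^sub>C x) ` B)" (is "_ \<subseteq> span ?C")
proof (rule complex_vector.span_minimal)
  show "B \<subseteq> span ?C" by (auto intro: span_base)
  have i: "\<i> *\<^sub>C x \<in> span ?C" if "x \<in> span ?C" for x
    using that
  proof (induction rule: span_induct_alt)
    case base
    show ?case by (simp add: span_zero)
  next
    case (step c x y)
    from step(1) consider "x \<in> B" | b where "b \<in> B" "x = \<i> *\<^sub>C b" by auto
    then have "\<i> *\<^sub>C x \<in> span ?C"
    proof cases
      case 1
      then show ?thesis by (auto intro: span_base)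
    next
      case 2
      then have "\<i> *\<^sub>C x = - b" by (simp add: scaleC_scaleC)
      then show ?thesis using 2 by (auto intro: span_base span_neg)
    qed
    then show ?case
      using step(2) by (simp add: scaleC_add_right scaleC_scaleR span_add span_scale)
  qed
  show "complex_vector.subspace (span ?C)"
  proof (rule complex_vector.subspaceI)
    fix c x assume x: "x \<in> span ?C"
    have "c *\<^sub>C x = Re c *\<^sub>R x + Im c *\<^sub>R \<i> *\<^sub>C x"
      by (subst complex_eq[of c])
        (simp only: scaleC_add_left scaleC_of_real scaleC_scaleC[symmetric] scaleC_scaleR)
    then show "c *\<^sub>C x \<in> span ?C" using i[OF x] x by (simp add: span_add span_scale)
  qed (auto intro: span_zero span_add)
qed

section \<open>Square roots of positive definite operators\<close>

text \<open>Rescale to s A = 1 - T with \<open>norm T\<close> below 1, find a root 1 - Y of 1 - T by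
  Banach's fixed point theorem, and divide by the square root of s.\<close>

lemma positive_operator_sqrt:
  fixes A :: "'h::complex_hilbert \<Rightarrow>\<^sub>L 'h"
  assumes lin: "complex_linear A" and sym: "\<And>x y. A x \<bullet> y = x \<bullet> A y"
    and pos: "\<And>x. \<delta> * (norm x)\<^sup>2 \<le> A x \<bullet> x" and "0 < \<delta>"
  obtains V where "complex_linear V" "\<And>x y. blinfun_apply V x \<bullet> y = x \<bullet> V y" "\<And>x. V (V x) = A x"
proof -
  define a where "a = norm A + \<delta>"
  \<comment> \<open>This \<open>s\<close> minimises 1 - 2 s \<delta> + s^2 a^2, the bound for the
    square of \<open>norm T\<close>; the minimum is \<open>1 - (\<delta> / a)\<^sup>2\<close>. The
    summand \<delta> in \<open>a\<close> ensures \<delta> \<le> a, so the root is real.\<close>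
  define s where "s = \<delta> / a\<^sup>2"
  define \<tau> where "\<tau> = sqrt (1 - (\<delta> / a)\<^sup>2)"
  define T where "T = id_blinfun - s *\<^sub>R A"
  have a: "0 < a" "\<delta> \<le> a" using \<open>0 < \<delta>\<close> by (simp_all add: a_def add_nonneg_pos)
  have "0 < s" using a \<open>0 < \<delta>\<close> by (simp add: s_def)
  have q: "0 < (\<delta> / a)\<^sup>2" "(\<delta> / a)\<^sup>2 \<le> 1"
    using a \<open>0 < \<delta>\<close> by (simp_all add: power_le_one)
  then have \<tau>: "0 \<le> \<tau>" "\<tau> < 1" by (simp_all add: \<tau>_def)
  have T: "T x = x - s *\<^sub>R A x" for x by (simp add: T_def blinfun.diff_left blinfun.scaleR_left)
  have "norm T \<le> \<tau>"
  proof (rule norm_blinfun_bound[OF \<tau>(1)])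
    fix x
    have "norm (A x) \<le> a * norm x"
      using norm_blinfun[of A x] mult_nonneg_nonneg[OF less_imp_le[OF \<open>0 < \<delta>\<close>] norm_ge_zero[of x]]
      unfolding a_def distrib_right by linarith
    then have Ax: "(norm (A x))\<^sup>2 \<le> a\<^sup>2 * (norm x)\<^sup>2"
      using power_mono[of "norm (A x)" "a * norm x" 2] by (simp add: power_mult_distrib)
    have "(norm (T x))\<^sup>2 = (norm x)\<^sup>2 - 2 * s * (A x \<bullet> x) + s\<^sup>2 * (norm (A x))\<^sup>2"
      using inner_commute[of x "A x"] unfolding T power2_norm_eq_inner
      by (simp add: inner_diff_left inner_diff_right power2_eq_square algebra_simps)
    also have "\<dots> \<le> (norm x)\<^sup>2 - 2 * s * (\<delta> * (norm x)\<^sup>2) + s\<^sup>2 * (a\<^sup>2 * (norm x)\<^sup>2)"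
      using \<open>0 < s\<close> by (intro add_mono diff_mono mult_left_mono pos Ax) auto
    also have "\<dots> = (1 - (\<delta> / a)\<^sup>2) * (norm x)\<^sup>2"
      using a by (simp add: s_def power2_eq_square field_simps)
    also have "\<dots> = (\<tau> * norm x)\<^sup>2" using q by (simp add: \<tau>_def power_mult_distrib)
    finally show "norm (T x) \<le> \<tau> * norm x" by (rule power2_le_imp_le) (use \<tau> in simp)
  qed
  \<comment> \<open>If \<open>Y = (T + Y\<^sup>2) / 2\<close> then \<open>(1 - Y)\<^sup>2 = 1 - T\<close>; the map is a contraction of the ball of radius \<open>r\<close>.\<close>
  define r where "r = 1 - sqrt (1 - \<tau>)"
  have r: "0 \<le> r" "r < 1" using \<tau> by (simp_all add: r_def)
  have r_eq: "\<tau> + r * r = 2 * r"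
    using \<tau> real_sqrt_pow2[of "1 - \<tau>"] by (simp add: r_def power2_eq_square algebra_simps)
  \<comment> \<open>Symmetry and complex linearity are built into the complete set, so the fixed
    point inherits them.\<close>
  define X where "X = {Y :: 'h \<Rightarrow>\<^sub>L 'h. norm Y \<le> r} \<inter> {Y. \<forall>c x. blinfun_apply Y (c *\<^sub>C x) = c *\<^sub>C Y x}
      \<inter> {Y. \<forall>x y. blinfun_apply Y x \<bullet> y = x \<bullet> Y y}"
  define f where "f Y = (1 / 2) *\<^sub>R (T + (Y o\<^sub>L Y))" for Y
  have f: "f Y x = (1 / 2) *\<^sub>R (T x + Y (Y x))" for Y x
    by (simp add: f_def blinfun.scaleR_left blinfun.add_left)
  have "closed X"
    unfolding X_def
    by (intro closed_Int closed_Collect_le closed_Collect_all closed_Collect_eq continuous_intros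
        bounded_linear.continuous_on[OF bounded_linear_scaleC])
  then have "complete X" by (simp add: complete_eq_closed)
  moreover have "0 \<in> X" using r by (simp add: X_def)
  then have "X \<noteq> {}" by blast
  moreover have "f ` X \<subseteq> X"
  proof (rule image_subsetI)
    fix Y assume Y: "Y \<in> X"
    have "norm (Y o\<^sub>L Y) \<le> r * r"
      using Y r by (intro order_trans[OF norm_blinfun_compose] mult_mono) (auto simp: X_def)
    then have "norm (f Y) \<le> r"
      using norm_triangle_ineq[of T "Y o\<^sub>L Y"] \<open>norm T \<le> \<tau>\<close> r_eq by (simp add: f_def)
    moreover have "f Y (c *\<^sub>C x) = c *\<^sub>C f Y x" for c x
      using Y lin
      by (simp add: X_def f T complex_linear_def scaleC_add_right scaleC_scaleR
          complex_vector.scale_right_diff_distrib)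
    moreover have "f Y x \<bullet> y = x \<bullet> f Y y" for x y
      using Y by (simp add: X_def f T inner_simps sym)
    ultimately show "f Y \<in> X" by (simp add: X_def)
  qed
  moreover have "dist (f Y) (f Z) \<le> r * dist Y Z" if YZ: "Y \<in> X" "Z \<in> X" for Y Z
  proof -
    \<comment> \<open>Y^2 - Z^2 = Y(Y - Z) + (Y - Z)Z holds for noncommuting operators and yields
      the contraction constant \<open>r\<close>.\<close>
    have "f Y - f Z = (1 / 2) *\<^sub>R ((Y o\<^sub>L (Y - Z)) + ((Y - Z) o\<^sub>L Z))"
      by (rule blinfun_eqI)
        (simp add: f blinfun.diff_left blinfun.diff_right blinfun.add_left blinfun.scaleR_left
          flip: scaleR_diff_right)
    then have "norm (f Y - f Z) \<le> (norm (Y o\<^sub>L (Y - Z)) + norm ((Y - Z) o\<^sub>L Z)) / 2"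
      using norm_triangle_ineq[of "Y o\<^sub>L (Y - Z)" "(Y - Z) o\<^sub>L Z"] by simp
    also have "norm (Y o\<^sub>L (Y - Z)) \<le> r * norm (Y - Z)"
      using YZ by (intro order_trans[OF norm_blinfun_compose] mult_right_mono) (auto simp: X_def)
    also have "norm ((Y - Z) o\<^sub>L Z) \<le> norm (Y - Z) * r"
      using YZ by (intro order_trans[OF norm_blinfun_compose] mult_left_mono) (auto simp: X_def)
    finally show ?thesis by (simp add: dist_norm)
  qed
  ultimately have "\<exists>!Y\<in>X. f Y = Y"
    using r by (intro Banach_fix) auto
  then obtain Y where Y: "Y \<in> X" "f Y = Y" by blast
  have YY: "Y (Y x) = 2 *\<^sub>R Y x - T x" for x
    using arg_cong[OF f[of Y x], of "scaleR 2"] unfolding Y(2) by simp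
  define V where "V = (1 / sqrt s) *\<^sub>R (id_blinfun - Y)"
  have V: "V x = (1 / sqrt s) *\<^sub>R (x - Y x)" for x
    by (simp add: V_def blinfun.scaleR_left blinfun.diff_left)
  show thesis
  proof
    show "complex_linear V"
      using Y(1) by (simp add: complex_linear_def X_def V scaleC_scaleR
          complex_vector.scale_right_diff_distrib)
    show "V x \<bullet> y = x \<bullet> V y" for x y
      using Y(1) by (simp add: X_def V inner_simps)
    show "V (V x) = A x" for x
    proof -
      have "V (V x) = (1 / s) *\<^sub>R (x - Y x - (Y x - Y (Y x)))"
        using \<open>0 < s\<close> by (simp add: V blinfun.scaleR_right blinfun.diff_right
            flip: scaleR_diff_right)
      also have "x - Y x - (Y x - Y (Y x)) = s *\<^sub>R A x"
        unfolding YY T by (simp add: scaleR_2)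
      finally show ?thesis using \<open>0 < s\<close> by simp
    qed
  qed
qed

section \<open>Invertible operators, representations and unitarisation\<close>

lemma inv_invertible_operators:
  fixes V W :: "'h::complex_inner \<Rightarrow>\<^sub>L 'h"
  assumes "complex_linear V" "complex_linear W" "\<And>x. V (W x) = x" "\<And>x. W (V x) = x"
  shows "V \<in> carrier invertible_operators" "W \<in> carrier invertible_operators"
    "inv\<^bsub>invertible_operators\<^esub> V = W"
proof -
  have eqs: "W o\<^sub>L V = id_blinfun" "V o\<^sub>L W = id_blinfun"
    by (auto intro!: blinfun_eqI simp: assms(3,4))
  show V: "V \<in> carrier invertible_operators" and W: "W \<in> carrier invertible_operators"
    using assms(1,2) eqs by (auto simp: invertible_operators_def)
  show "inv\<^bsub>invertible_operators\<^esub> V = W"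
    using V W eqs by (intro group.inv_equality[OF group_invertible_operators])
      (auto simp: invertible_operators_def)
qed

lemma representationD:
  assumes "group G" "representation G \<pi>"
  shows "g \<in> carrier G \<Longrightarrow> complex_linear (\<pi> g)"
    and "g \<in> carrier G \<Longrightarrow> \<pi> g \<in> carrier invertible_operators"
    and "g \<in> carrier G \<Longrightarrow> h \<in> carrier G \<Longrightarrow> \<pi> (g \<otimes>\<^bsub>G\<^esub> h) = \<pi> g o\<^sub>L \<pi> h"
    and "\<pi> \<one>\<^bsub>G\<^esub> = id_blinfun"
    and "g \<in> carrier G \<Longrightarrow> \<pi> (inv\<^bsub>G\<^esub> g) (\<pi> g x) = x"
    and "g \<in> carrier G \<Longrightarrow> \<pi> g (\<pi> (inv\<^bsub>G\<^esub> g) x) = x"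
proof -
  interpret group G by fact
  have hom: "\<pi> \<in> hom G invertible_operators" using assms(2) by (simp add: representation_def)
  show lin: "g \<in> carrier G \<Longrightarrow> \<pi> g \<in> carrier invertible_operators" for g
    using hom by (auto simp: hom_def)
  then show "g \<in> carrier G \<Longrightarrow> complex_linear (\<pi> g)" by (auto simp: invertible_operators_def)
  show mult: "g \<in> carrier G \<Longrightarrow> h \<in> carrier G \<Longrightarrow> \<pi> (g \<otimes>\<^bsub>G\<^esub> h) = \<pi> g o\<^sub>L \<pi> h" for g h
    using hom by (simp add: hom_def invertible_operators_def)
  show one: "\<pi> \<one>\<^bsub>G\<^esub> = id_blinfun"
    using hom_one[OF hom is_group group_invertible_operators] by (simp add: invertible_operators_def)
  show "g \<in> carrier G \<Longrightarrow> \<pi> (inv\<^bsub>G\<^esub> g) (\<pi> g x) = x"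
    using mult[of "inv\<^bsub>G\<^esub> g" g] one by (metis blinfun_apply_blinfun_compose blinfun_apply_id_blinfun inv_closed l_inv)
  show "g \<in> carrier G \<Longrightarrow> \<pi> g (\<pi> (inv\<^bsub>G\<^esub> g) x) = x"
    using mult[of g "inv\<^bsub>G\<^esub> g"] one by (metis blinfun_apply_blinfun_compose blinfun_apply_id_blinfun inv_closed r_inv)
qed

text \<open>The unitary representation is U = V \<pi> W. Real invariance is enough, since each U(g)
  commutes with multiplication by i.\<close>

lemma unitarizes_of_invariant_form:
  fixes \<pi> :: "'g \<Rightarrow> 'h::complex_hilbert \<Rightarrow>\<^sub>L 'h"
  assumes G: "group G" "representation G \<pi>"
    and V: "complex_linear V" "complex_linear W" "\<And>x. V (W x) = x" "\<And>x. W (V x) = x"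
    and inv: "\<And>g x y. g \<in> carrier G \<Longrightarrow> V (\<pi> g x) \<bullet> V (\<pi> g y) = V x \<bullet> V y"
  shows "unitarizes G \<pi> V"
proof -
  note rep = representationD[OF G]
  note V_inv = inv_invertible_operators[OF V]
  interpret I: group "invertible_operators :: ('h \<Rightarrow>\<^sub>L 'h) monoid" by (rule group_invertible_operators)
  have mult: "S \<otimes>\<^bsub>invertible_operators\<^esub> T = S o\<^sub>L T" for S T :: "'h \<Rightarrow>\<^sub>L 'h"
    by (simp add: invertible_operators_def)
  define U where "U g = V o\<^sub>L \<pi> g o\<^sub>L W" for g
  have U_in: "U g \<in> carrier invertible_operators" if "g \<in> carrier G" for g
    using I.m_closed[OF I.m_closed[OF V_inv(1) rep(2)[OF that]] V_inv(2)] by (simp add: mult U_def)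
  have "U (g \<otimes>\<^bsub>G\<^esub> h) = U g o\<^sub>L U h" if "g \<in> carrier G" "h \<in> carrier G" for g h
    by (rule blinfun_eqI) (simp add: U_def rep(3)[OF that] V(4))
  then have "representation G U"
    using U_in by (auto simp: representation_def hom_def mult)
  moreover have "cinner (U g x) (U g y) = cinner x y" if g: "g \<in> carrier G" for g x y
  proof -
    have "U g x \<bullet> U g y = x \<bullet> y" for x y
      using inv[OF g, of "W x" "W y"] by (simp add: U_def V(3))
    moreover have "\<i> *\<^sub>C U g y = U g (\<i> *\<^sub>C y)"
      using V(1,2) rep(1)[OF g] by (simp add: U_def complex_linear_def)
    ultimately show ?thesis by (simp add: cinner_eq_inner)
  qed
  moreover have "\<pi> g = inv\<^bsub>invertible_operators\<^esub> V o\<^sub>L U g o\<^sub>L V" for g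
    by (rule blinfun_eqI) (simp add: V_inv(3) U_def V(4))
  ultimately show ?thesis
    unfolding unitarizes_def unitary_representation_def using V_inv(1) by blast
qed

section \<open>Construction of the unitarising operator\<close>

lemma unitarizes_exists:
  fixes G :: "('g, 'm) monoid_scheme"
    and \<pi> :: "'g \<Rightarrow> 'h::complex_hilbert \<Rightarrow>\<^sub>L 'h"
    and P1 P2 :: "'h \<Rightarrow>\<^sub>L 'h"
  assumes G: "group G"
    and P2: "orthogonal_projection P2"
    and P12: "P1 + P2 = id_blinfun"
    and fin: "finite_dimensional (range (blinfun_apply P2))"
    and rep: "representation G \<pi>"
    and bound: "\<And>g. g \<in> carrier G \<Longrightarrow> norm (\<pi> g) \<le> M" and M: "1 \<le> M"
    and form: "\<forall>g\<in>carrier G. \<forall>x. indefinite_form P1 P2 (\<pi> g x) = indefinite_form P1 P2 x"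
  obtains V where "unitarizes G \<pi> V"
    "norm V * norm (inv\<^bsub>invertible_operators\<^esub> V) \<le> 2 * M\<^sup>2 + 1"
proof -
  interpret group G by (rule G)
  note rep' = representationD[OF G rep]
  have P1: "P1 x = x - P2 x" for x
    using arg_cong[OF P12, of "\<lambda>T. blinfun_apply T x"] by (simp add: blinfun.add_left algebra_simps)
  \<comment> \<open>This is P1 - P2, rewritten through P1 = 1 - P2.\<close>
  define J where "J = id_blinfun - 2 *\<^sub>R P2"
  have J: "J x = x - 2 *\<^sub>R P2 x" for x
    by (simp add: J_def blinfun.diff_left blinfun.scaleR_left)
  have P2_lin: "P2 (a *\<^sub>C x) = a *\<^sub>C P2 x" for a x
    using P2 by (simp add: orthogonal_projection_def complex_linear_def)
  have J_lin: "J (a *\<^sub>C x) = a *\<^sub>C J x" for a x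
    by (simp add: J P2_lin complex_vector.scale_right_diff_distrib scaleC_scaleR)
  have P2_P2: "P2 (P2 x) = P2 x" for x
    using P2 unfolding orthogonal_projection_def by (metis blinfun_apply_blinfun_compose)
  have P2_sym: "P2 x \<bullet> y = x \<bullet> P2 y" for x y
    using P2 by (simp add: orthogonal_projection_def inner_eq_Re_cinner)
  have form_J: "J x \<bullet> x = Re (indefinite_form P1 P2 x)" for x
    by (simp add: J P1 indefinite_form_def flip: inner_eq_Re_cinner)
      (simp add: inner_simps)
  define \<G> where "\<G> = {T :: 'h \<Rightarrow>\<^sub>L 'h. \<exists>a g. cmod a = 1 \<and> g \<in> carrier G \<and> (\<forall>x. T x = a *\<^sub>C \<pi> g x)}"
  have \<G>I: "\<exists>T\<in>\<G>. \<forall>x. T x = a *\<^sub>C \<pi> g x" if "cmod a = 1" "g \<in> carrier G" for a g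
  proof -
    have "bounded_linear (\<lambda>x. a *\<^sub>C \<pi> g x)"
      by (rule bounded_linear_compose[OF bounded_linear_scaleC blinfun.bounded_linear_right])
    then have "blinfun_apply (Blinfun (\<lambda>x. a *\<^sub>C \<pi> g x)) = (\<lambda>x. a *\<^sub>C \<pi> g x)"
      by (rule bounded_linear_Blinfun_apply)
    then show ?thesis using that unfolding \<G>_def by (intro bexI[of _ "Blinfun (\<lambda>x. a *\<^sub>C \<pi> g x)"]) auto
  qed
  interpret bounded_isometry_group J \<G> M
  proof
    show "J x \<bullet> y = x \<bullet> J y" for x y by (simp add: J inner_simps P2_sym)
    show "J (J x) = x" for x
      by (simp add: J blinfun.diff_right blinfun.add_right P2_P2 scaleR_2)
    show "id_blinfun \<in> \<G>"
      unfolding \<G>_def using rep'(4) by (auto intro!: exI[of _ 1] bexI[of _ "\<one>\<^bsub>G\<^esub>"] exI[of _ "\<one>\<^bsub>G\<^esub>"])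
    show "1 \<le> M" by (rule M)
    show "\<exists>C. finite C \<and> (\<forall>x. x - J x \<in> span C)"
    proof -
      obtain B where B: "finite B" "range P2 = complex_vector.span B"
        using fin by (auto simp: finite_dimensional_def)
      have "x - J x \<in> span (B \<union> (\<lambda>x. \<i> *\<^sub>C x) ` B)" for x
        using complex_span_subset_real_span[of B] B(2) by (auto simp: J intro!: span_scale)
      then show ?thesis using B(1) by blast
    qed
    fix T assume "T \<in> \<G>"
    then obtain a g where T: "cmod a = 1" "g \<in> carrier G" "\<And>x. T x = a *\<^sub>C \<pi> g x"
      by (auto simp: \<G>_def)
    show "J (T x) \<bullet> T x = J x \<bullet> x" for x
      using form T(1,2) by (simp add: T(3) J_lin inner_scaleC_scaleC form_J)
    show "norm T \<le> M"
    proof (rule norm_blinfun_bound)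
      show "norm (T x) \<le> M * norm x" for x
        using norm_blinfun[of "\<pi> g" x] mult_right_mono[OF bound[OF T(2)] norm_ge_zero[of x]] T
        by simp
    qed (use M in simp)
    have "a \<noteq> 0" using T(1) by auto
    then have "a * inverse a = 1" "cmod (inverse a) = 1" using T(1) by (auto simp: norm_inverse)
    obtain T' where T': "T' \<in> \<G>" "\<And>x. T' x = inverse a *\<^sub>C \<pi> (inv\<^bsub>G\<^esub> g) x"
      using \<G>I[OF \<open>cmod (inverse a) = 1\<close> inv_closed[OF T(2)]] by blast
    have "T' (T x) = x" "T (T' x) = x" for x
      using rep'(1)[OF T(2)] rep'(1)[OF inv_closed[OF T(2)]] \<open>a * inverse a = 1\<close>
      by (simp_all add: T(3) T'(2) complex_linear_def scaleC_scaleC rep'(5,6)[OF T(2)] mult.commute)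
    then show "\<exists>T'\<in>\<G>. (\<forall>x. T' (T x) = x) \<and> (\<forall>x. T (T' x) = x)" using T'(1) by blast
    fix S assume "S \<in> \<G>"
    then obtain b h where S: "cmod b = 1" "h \<in> carrier G" "\<And>x. S x = b *\<^sub>C \<pi> h x"
      by (auto simp: \<G>_def)
    have "(S o\<^sub>L T) x = (b * a) *\<^sub>C \<pi> (h \<otimes>\<^bsub>G\<^esub> g) x" for x
      using rep'(1)[OF S(2)] by (simp add: S(3) T(3) rep'(3)[OF S(2) T(2)] complex_linear_def scaleC_scaleC)
    moreover have "cmod (b * a) = 1" "h \<otimes>\<^bsub>G\<^esub> g \<in> carrier G" using S T by (auto simp: norm_mult)
    ultimately show "S o\<^sub>L T \<in> \<G>" unfolding \<G>_def by blast
  qed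
  obtain P where P: "admissible P" "\<And>x. P (P x) = P x" "\<And>T x. T \<in> \<G> \<Longrightarrow> P (T x) = T (P x)"
    using invariant_projection by blast
  have P_unimodular: "P (a *\<^sub>C \<pi> g x) = a *\<^sub>C \<pi> g (P x)" if "cmod a = 1" "g \<in> carrier G" for a g x
    using \<G>I[OF that] P(3) by metis
  have P_\<pi>: "P (\<pi> g x) = \<pi> g (P x)" if "g \<in> carrier G" for g x
    using P_unimodular[OF _ that, of 1] by simp
  \<comment> \<open>At the identity of the group, commutation with a \<pi>(1) is commutation with
    the unimodular scalar a.\<close>
  have P_lin: "complex_linear P"
    using P_unimodular[OF _ one_closed] by (intro complex_linear_of_unimodular) (simp add: rep'(4))
  define \<kappa> where "\<kappa> = 2 * M\<^sup>2 + 1"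
  have \<kappa>: "0 < \<kappa>" unfolding \<kappa>_def by (intro add_nonneg_pos) auto
  define A where "A = J o\<^sub>L (id_blinfun - 2 *\<^sub>R P)"
  have A: "A x = J (x - 2 *\<^sub>R P x)" for x
    by (simp add: A_def blinfun.diff_left blinfun.scaleR_left)
  have A_form: "A x \<bullet> x = J x \<bullet> x + 2 * neg_form P x x" for x
    by (simp add: A neg_form_def blinfun.diff_right blinfun.scaleR_right inner_simps)
  have A_lower: "(norm x)\<^sup>2 \<le> \<kappa> * (A x \<bullet> x)" for x
    using majorant_lower_bound[OF P(1), of x] by (simp add: A_form \<kappa>_def)
  have A_upper: "A x \<bullet> x \<le> \<kappa> * (norm x)\<^sup>2" for x
    using form_bound[of x x] admissibleD(5)[OF P(1), of x]
    by (simp add: A_form \<kappa>_def power2_eq_square algebra_simps)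
  have A_lin: "complex_linear A"
    using P_lin by (simp add: complex_linear_def A blinfun.diff_right blinfun.scaleR_right J_lin
        scaleC_scaleR complex_vector.scale_right_diff_distrib)
  have A_sym: "A x \<bullet> y = x \<bullet> A y" for x y
    using admissibleD(1)[OF P(1), of x y] J_sym[of x y] J_sym[of x "P y"]
    by (simp add: A blinfun.diff_right blinfun.scaleR_right inner_simps)
  \<comment> \<open>Both J and 1 - 2P are involutions, so A = J(1 - 2P) has right inverse
    JAJ.\<close>
  have A_J_A: "A (J (A (J x))) = x" for x
    by (simp add: A blinfun.diff_right blinfun.add_right blinfun.minus_right P(2) scaleR_2)
  have A_\<pi>: "A (\<pi> g x) \<bullet> \<pi> g y = A x \<bullet> y" if g: "g \<in> carrier G" for g x y
  proof -
    have "\<exists>T\<in>\<G>. \<forall>x. T x = \<pi> g x" using \<G>I[OF _ g, of 1] by simp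
    then have "J (\<pi> g u) \<bullet> \<pi> g y = J u \<bullet> y" for u using isometric2 by metis
    moreover have "A (\<pi> g x) = J (\<pi> g (x - 2 *\<^sub>R P x))"
      by (simp add: A P_\<pi>[OF g] blinfun.diff_right blinfun.scaleR_right)
    ultimately show ?thesis by (simp add: A)
  qed
  obtain V where V: "complex_linear V" "\<And>x y. V x \<bullet> y = x \<bullet> V y" "\<And>x. V (V x) = A x"
    using positive_operator_sqrt[OF A_lin A_sym, of "1 / \<kappa>"] A_lower \<kappa> by (auto simp: field_simps)
  have V_form: "V x \<bullet> V y = A x \<bullet> y" for x y
    using V(2)[of "V x" y] by (simp add: V(3))
  \<comment> \<open>W is V times JAJ, a right inverse of \<open>V\<close> because V V = A. That it
    is also a left inverse follows from the injectivity of \<open>V\<close>, a consequence of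
    \<open>A_lower\<close>.\<close>
  define W where "W = V o\<^sub>L J o\<^sub>L A o\<^sub>L J"
  have W_lin: "complex_linear W"
    using V(1) A_lin by (simp add: complex_linear_def W_def J_lin)
  have V_W: "V (W x) = x" for x
    by (simp add: W_def V(3) A_J_A)
  have W_V: "W (V x) = x" for x
  proof -
    let ?y = "W (V x) - x"
    have "V ?y = 0" by (simp add: blinfun.diff_right V_W)
    then have "A ?y \<bullet> ?y = 0" using V_form[of ?y ?y] by simp
    then show ?thesis using A_lower[of ?y] by simp
  qed
  have norm_V: "norm (V x) \<le> sqrt \<kappa> * norm x" for x
  proof (rule power2_le_imp_le)
    show "(norm (V x))\<^sup>2 \<le> (sqrt \<kappa> * norm x)\<^sup>2"
      using A_upper[of x] \<kappa> V_form[of x x] by (simp add: power_mult_distrib dot_square_norm)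
  qed (use \<kappa> in simp)
  \<comment> \<open>\<open>A_lower\<close> at \<open>W x\<close>, where the form of A equals |V W
    x|^2 = |x|^2.\<close>
  have norm_W: "norm (W x) \<le> sqrt \<kappa> * norm x" for x
  proof (rule power2_le_imp_le)
    show "(norm (W x))\<^sup>2 \<le> (sqrt \<kappa> * norm x)\<^sup>2"
      using A_lower[of "W x"] \<kappa> V_form[of "W x" "W x"]
      by (simp add: power_mult_distrib dot_square_norm V_W)
  qed (use \<kappa> in simp)
  show thesis
  proof
    show "unitarizes G \<pi> V"
      by (rule unitarizes_of_invariant_form[OF G rep V(1) W_lin V_W W_V]) (simp add: V_form A_\<pi>)
    have "norm V * norm W \<le> sqrt \<kappa> * sqrt \<kappa>"
      using \<kappa> by (intro mult_mono norm_blinfun_bound norm_V norm_W) auto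
    then show "norm V * norm (inv\<^bsub>invertible_operators\<^esub> V) \<le> 2 * M\<^sup>2 + 1"
      using \<kappa> inv_invertible_operators(3)[OF V(1) W_lin V_W W_V] by (simp add: \<kappa>_def)
  qed
qed

section \<open>Similarity and the bound on the similarity constant\<close>

theorem theorem4p1:
  fixes G :: "('g, 'm) monoid_scheme"
    and \<pi> :: "'g \<Rightarrow> 'h::complex_hilbert \<Rightarrow>\<^sub>L 'h"
    and P1 P2 :: "'h \<Rightarrow>\<^sub>L 'h"
  assumes "group G"
    and "orthogonal_projection P1" and "orthogonal_projection P2"
    and "P1 + P2 = id_blinfun"
    and "finite_dimensional (range (blinfun_apply P2))"
    and "bounded_representation G \<pi>"
    and "\<forall>g\<in>carrier G. \<forall>x. indefinite_form P1 P2 (\<pi> g x) = indefinite_form P1 P2 x"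
  shows "similar_to_unitary G \<pi> \<and> similarity_constant G \<pi> \<le> 2 * (rep_norm G \<pi>)\<^sup>2 + 1"
proof -
  interpret group G by fact
  have rep: "representation G \<pi>" and bdd: "bdd_above ((\<lambda>g. norm (\<pi> g)) ` carrier G)"
    using assms(6) by (auto simp: bounded_representation_def)
  have bound: "norm (\<pi> g) \<le> rep_norm G \<pi>" if "g \<in> carrier G" for g
    unfolding rep_norm_def by (rule cSUP_upper[OF that bdd])
  \<comment> \<open>The maximum with 1 covers the trivial space, where every operator norm is 0. On
    a nontrivial space the identity element forces the norm of \<pi> to be at least 1.\<close>
  then obtain V where V: "unitarizes G \<pi> V"
    "norm V * norm (inv\<^bsub>invertible_operators\<^esub> V) \<le> 2 * (max 1 (rep_norm G \<pi>))\<^sup>2 + 1"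
    using unitarizes_exists[OF assms(1,3,4,5) rep _ _ assms(7), of "max 1 (rep_norm G \<pi>)"]
    by (metis max.cobounded1 max.coboundedI2)
  have "norm V * norm (inv\<^bsub>invertible_operators\<^esub> V) \<le> 2 * (rep_norm G \<pi>)\<^sup>2 + 1"
  proof (cases "\<exists>x::'h. x \<noteq> 0")
    case True
    then obtain x :: 'h where "x \<noteq> 0" by blast
    have "norm x \<le> rep_norm G \<pi> * norm x"
      using norm_blinfun[of "\<pi> \<one>\<^bsub>G\<^esub>" x] mult_right_mono[OF bound[OF one_closed] norm_ge_zero[of x]]
      by (simp add: representationD(4)[OF assms(1) rep])
    then have "max 1 (rep_norm G \<pi>) = rep_norm G \<pi>" using \<open>x \<noteq> 0\<close> by (simp add: max_def)
    then show ?thesis using V(2) by simp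
  next
    case False
    then have "V = 0" by (intro blinfun_eqI) (metis blinfun.zero_left)
    then show ?thesis by simp
  qed
  moreover have "similarity_constant G \<pi> \<le> norm V * norm (inv\<^bsub>invertible_operators\<^esub> V)"
    unfolding similarity_constant_def
    by (rule cInf_lower) (use V(1) in \<open>auto intro!: bdd_belowI[of _ 0]\<close>)
  ultimately show ?thesis using V(1) by (auto simp: similar_to_unitary_def)
qed

end
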